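(* Let $m,n\in\mathbb{N}$ and let $f\in C^\infty(\mathbb{T}^m\times\mathbb{R}^n)\cap L^1(\mathbb{T}^m\times\mathbb{R}^n)$. Then $f\in\mathcal{S}(\mathbb{T}^m\times\mathbb{R}^n)$ if and only if $\widehat{f}(t,\xi)$ is smooth on $\mathbb{T}^m\times\mathbb{R}^n$ and for every $\alpha\in\mathbb{N}_0^m$, $\beta\in\mathbb{N}_0^n$ and $N>0$ there exists $C_{N,\alpha,\beta}>0$ such that $$|\partial_t^\alpha\partial_\xi^\beta\widehat{f}(t,\xi)|\leq C_{N,\alpha,\beta}(1+|\xi|^2)^{-N/2}$$ for every $t\in\mathbb{T}^m$ and $\xi\in\mathbb{R}^n$.
   Context: $\mathbb{T}^m=(\mathbb{R}/2\pi\mathbb{Z})^m$; functions on $\mathbb{T}^m\times\mathbb{R}^n$ (variables $(t,x)$) are identified with functions on $\mathbb{R}^{m+n}$ that are $2\pi$-periodic in each of the first $m$ variables. $\mathbb{N}_0$ denotes the nonnegative integers. $\mathcal{S}(\mathbb{T}^m\times\mathbb{R}^n)$ is the set of all $f\in C^\infty(\mathbb{T}^m\times\mathbb{R}^n)$ (complex valued) such that $\|f\|_{\alpha,\beta,\gamma}:=\sup_{(t,x)\in\mathbb{T}^m\times\mathbb{R}^n}|x^\gamma\partial_t^\alpha\partial_x^\beta f(t,x)|<+\infty$ for all $\alpha\in\mathbb{N}_0^m$, $\beta,\gamma\in\mathbb{N}_0^n$. The partial Fourier transform in the Euclidean variable is $\widehat{f}(t,\xi)=\mathcal{F}_{\mathbb{R}^n}(f)(t,\xi):=\int_{\mathbb{R}^n}f(t,x)e^{-ix\cdot\xi}\,dx$,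 defined for a.e. $t$ and all $\xi\in\mathbb{R}^n$ when $f\in L^1(\mathbb{T}^m\times\mathbb{R}^n)$; as this is defined only for a.e. $t$, "$\widehat f$ is smooth" means that it agrees almost everywhere with a smooth function, which is then denoted by $\widehat f$. *)

theory Defs
  imports "HOL-Analysis.Analysis"
begin

text \<open>
  Functions on \<open>T^m \<times> R^n\<close> are functions on \<open>R^m \<times> R^n\<close>, represented by the product type
  \<open>(real^'m) \<times> (real^'n)\<close>, that are \<open>2\<pi>\<close>-periodic in each of the first \<open>m\<close> variables.
\<close>

definition torus_periodic :: "((real^'m) \<times> (real^'n) \<Rightarrow> complex) \<Rightarrow> bool" where
  "torus_periodic f \<longleftrightarrow> (\<forall>i t x. f (t + axis i (2 * pi), x) = f (t, x))"

definition partial_deriv :: "'a::real_normed_vector \<Rightarrow> ('a \<Rightarrow> complex) \<Rightarrow> 'a \<Rightarrow> complex" where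
  "partial_deriv v f p = vector_derivative (\<lambda>s::real. f (p + s *\<^sub>R v)) (at 0)"

primrec C_k :: "nat \<Rightarrow> ('a::euclidean_space \<Rightarrow> complex) \<Rightarrow> bool" where
  "C_k 0 f \<longleftrightarrow> continuous_on UNIV f"
| "C_k (Suc k) f \<longleftrightarrow> continuous_on UNIV f \<and>
     (\<forall>b\<in>Basis. (\<forall>p. (\<lambda>s::real. f (p + s *\<^sub>R b)) differentiable (at 0)) \<and>
                C_k k (partial_deriv b f))"

definition smooth_torus :: "((real^'m) \<times> (real^'n) \<Rightarrow> complex) set" where
  "smooth_torus = {f. torus_periodic f \<and> (\<forall>k. C_k k f)}"

text \<open>
  Multi-indices are functions \<open>'k \<Rightarrow> nat\<close> on the finite index type. A finite type carries no
  canonical order, so the order in which the partial derivatives are composed is an arbitrary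
  fixed enumeration of the indices; it is irrelevant for smooth functions, whose partial
  derivatives commute.
\<close>

definition index_list :: "'k::finite list" where
  "index_list = (SOME ks. distinct ks \<and> set ks = UNIV)"

lemma index_list:
  "distinct (index_list :: 'k::finite list)" "set (index_list :: 'k list) = UNIV"
proof -
  have "\<exists>ks :: 'k list. distinct ks \<and> set ks = UNIV"
    using finite_distinct_list[of "UNIV :: 'k set"] by auto
  then have "distinct (index_list :: 'k list) \<and> set (index_list :: 'k list) = UNIV"
    unfolding index_list_def by (rule someI_ex)
  then show "distinct (index_list :: 'k list)" "set (index_list :: 'k list) = UNIV" by auto
qed

definition multi_deriv ::
    "('k::finite \<Rightarrow> 'a::real_normed_vector) \<Rightarrow> ('k \<Rightarrow> nat) \<Rightarrow> ('a \<Rightarrow> complex) \<Rightarrow> 'a \<Rightarrow> complex" where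
  "multi_deriv e \<alpha> f = foldr (\<lambda>k. partial_deriv (e k) ^^ \<alpha> k) index_list f"

definition deriv_t ::
    "('m::finite \<Rightarrow> nat) \<Rightarrow> ((real^'m) \<times> (real^'n) \<Rightarrow> complex) \<Rightarrow> (real^'m) \<times> (real^'n) \<Rightarrow> complex" where
  "deriv_t = multi_deriv (\<lambda>i. (axis i 1, 0))"

definition deriv_x ::
    "('n::finite \<Rightarrow> nat) \<Rightarrow> ((real^'m) \<times> (real^'n) \<Rightarrow> complex) \<Rightarrow> (real^'m) \<times> (real^'n) \<Rightarrow> complex" where
  "deriv_x = multi_deriv (\<lambda>j. (0, axis j 1))"

definition monomial :: "('n::finite \<Rightarrow> nat) \<Rightarrow> real^'n \<Rightarrow> real" where
  "monomial \<gamma> x = (\<Prod>j\<in>UNIV. (x $ j) ^ \<gamma> j)"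

definition schwartz_seminorm ::
    "('m::finite \<Rightarrow> nat) \<Rightarrow> ('n::finite \<Rightarrow> nat) \<Rightarrow> ('n \<Rightarrow> nat) \<Rightarrow>
     ((real^'m) \<times> (real^'n) \<Rightarrow> complex) \<Rightarrow> ennreal" where
  "schwartz_seminorm \<alpha> \<beta> \<gamma> f =
     (SUP (t, x)\<in>UNIV. ennreal (norm (of_real (monomial \<gamma> x) * deriv_t \<alpha> (deriv_x \<beta> f) (t, x))))"

definition schwartz_space :: "((real^'m) \<times> (real^'n) \<Rightarrow> complex) set" where
  "schwartz_space = {f \<in> smooth_torus. \<forall>\<alpha> \<beta> \<gamma>. schwartz_seminorm \<alpha> \<beta> \<gamma> f < \<infinity>}"

text \<open>The measure of \<open>T^m \<times> R^n\<close>: Lebesgue measure on the fundamental domain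
  \<open>[0, 2\<pi>)^m \<times> R^n\<close>.\<close>

definition torus_measure :: "((real^'m) \<times> (real^'n)) measure" where
  "torus_measure = restrict_space lborel ({t. \<forall>i. 0 \<le> t $ i \<and> t $ i < 2 * pi} \<times> UNIV)"

text \<open>At the null set of those \<open>t\<close> for which \<open>f (t, \<cdot>)\<close> is not integrable the value below is the
  default \<open>0\<close> of the Bochner integral; results are only to be stated up to null sets.\<close>

definition partial_fourier ::
    "((real^'m) \<times> (real^'n) \<Rightarrow> complex) \<Rightarrow> (real^'m) \<times> (real^'n) \<Rightarrow> complex" where
  "partial_fourier f = (\<lambda>(t, \<xi>). LINT x|lborel. f (t, x) * exp (- \<i> * of_real (x \<bullet> \<xi>)))"

end

theory Submission
  imports Defs "HOL-Probability.Probability" "HOL-Real_Asymp.Real_Asymp"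
begin

text \<open>
  The condition \<open>x\<^sup>\<gamma> \<partial>\<^sub>t\<^sup>\<alpha> \<partial>\<^sub>x\<^sup>\<beta> f\<close> bounded for all multi-indices says that \<open>f\<close> and all its partial
  derivatives, in whatever order they are taken, decay faster than every power of
  \<open>1 + \<bar>x\<bar>\<^sup>2\<close> in the Euclidean variable, uniformly in \<open>t\<close>. This class of functions, called
  \<open>rapid\<close> below, is the largest class of continuous, fast decaying functions that is closed under
  partial derivatives along the axes, and it is introduced coinductively in exactly this form. To
  prove that a function is \<open>rapid\<close> it then suffices to put it into some family of continuous,
  fast decaying functions that is closed under differentiation, which replaces Leibniz formulas
  and bookkeeping with multi-indices. Multi-indices are dealt with in
  \<open>schwartz_space_iff_rapid\<close> and \<open>rapidI_multi_deriv\<close>: since mixed partial derivatives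
  commute, every iterated partial derivative is one of the \<open>\<partial>\<^sub>t\<^sup>\<alpha> \<partial>\<^sub>x\<^sup>\<beta>\<close>.

  The partial Fourier transform \<open>F\<close> with kernel \<open>exp (i \<sigma> x \<bullet> \<xi>)\<close>, \<open>\<sigma> = \<plusminus> 1\<close>, maps rapid functions to
  rapid functions (\<open>rapid_fourier\<close>), because the family of all \<open>F f\<close> with \<open>f\<close> rapid has the
  required closure properties:
  \<open>\<partial>\<^sub>t F f = F (\<partial>\<^sub>t f)\<close>, \<open>\<partial>\<^sub>\<xi> F f = F (i \<sigma> x f)\<close>, and \<open>(1 + \<bar>\<xi>\<bar>\<^sup>2) F f = F (f - \<Delta>\<^sub>x f)\<close>, so that
  \<open>(1 + \<bar>\<xi>\<bar>\<^sup>2)\<^sup>N F f\<close> is again a transform and hence bounded. With \<open>\<sigma> = -1\<close> this is the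
  implication from left to right.

  For the converse, let \<open>g\<close> be the smooth version of the transform of \<open>f\<close>. The estimates say that
  \<open>g\<close> is rapid, so \<open>h = (2\<pi>)\<^sup>-\<^sup>n F g\<close> with \<open>\<sigma> = 1\<close> is rapid too. By Fubini, for almost every
  \<open>t\<close> the slice \<open>f (t, \<cdot>)\<close> is integrable and its transform is \<open>g (t, \<cdot>)\<close> almost everywhere, and
  Fourier inversion (\<open>fourier_inversion\<close>) gives \<open>f (t, \<cdot>) = h (t, \<cdot>)\<close> for these \<open>t\<close>. By continuity and
  periodicity \<open>f = h\<close>, so \<open>f\<close> is a Schwartz function.
\<close>

section \<open>Functions of rapid decay\<close>

text \<open>Differentiability at parameter \<open>0\<close> is demanded at every base point, so translating the base
  point along the line gives the derivative at every parameter.\<close>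
lemma has_partial_deriv:
  assumes "\<And>p. (\<lambda>s::real. f (p + s *\<^sub>R v)) differentiable (at 0)"
  shows "((\<lambda>s. f (p + s *\<^sub>R v)) has_vector_derivative partial_deriv v f (p + s0 *\<^sub>R v)) (at s0)"
proof -
  have "((\<lambda>s. f ((p + s0 *\<^sub>R v) + s *\<^sub>R v)) has_vector_derivative partial_deriv v f (p + s0 *\<^sub>R v)) (at 0)"
    using assms unfolding partial_deriv_def vector_derivative_works by blast
  then have "((\<lambda>s. f (p + (s0 + s) *\<^sub>R v)) has_vector_derivative partial_deriv v f (p + s0 *\<^sub>R v)) (at 0)"
    by (simp add: scaleR_add_left add.assoc)
  then have "((\<lambda>s. f (p + (s0 + s) *\<^sub>R v)) has_vector_derivative partial_deriv v f (p + s0 *\<^sub>R v)) (at (s0 - s0))"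
    by simp
  from vector_diff_chain_at[of "\<lambda>s. s - s0" 1 s0, OF _ this]
  moreover have "((\<lambda>s. s - s0) has_vector_derivative 1) (at s0)"
    by (auto intro!: derivative_eq_intros)
  ultimately show ?thesis by (simp add: o_def)
qed

lemma partial_deriv_eqI:
  "((\<lambda>s. f (p + s *\<^sub>R v)) has_vector_derivative D) (at 0) \<Longrightarrow> partial_deriv v f p = D"
  unfolding partial_deriv_def by (rule vector_derivative_at)

text \<open>Decay is measured with the powers of \<open>1 + \<bar>x\<bar>\<^sup>2\<close>: they dominate all monomials, and
  they are what \<open>1 - \<Delta>\<close> becomes under the Fourier transform.\<close>
definition decays :: "('a \<times> 'b::real_normed_vector \<Rightarrow> complex) \<Rightarrow> bool" where
  "decays f \<longleftrightarrow> (\<forall>N. \<exists>C. \<forall>p. norm (f p) * (1 + (norm (snd p))\<^sup>2) ^ N \<le> C)"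

lemma one_plus_square_pos: "0 < (1 + (norm x)\<^sup>2) ^ N" "1 \<le> (1 + (norm x)\<^sup>2) ^ N"
  by (auto intro!: zero_less_power add_pos_nonneg one_le_power)

lemma decays_add:
  assumes "decays f" "decays g"
  shows "decays (\<lambda>p. f p + g p)"
  unfolding decays_def
proof
  fix N
  obtain C D where C: "\<And>p. norm (f p) * (1 + (norm (snd p))\<^sup>2) ^ N \<le> C"
    and D: "\<And>p. norm (g p) * (1 + (norm (snd p))\<^sup>2) ^ N \<le> D"
    using assms unfolding decays_def by metis
  have "norm (f p + g p) * (1 + (norm (snd p))\<^sup>2) ^ N \<le> C + D" for p
  proof -
    have "norm (f p + g p) * (1 + (norm (snd p))\<^sup>2) ^ N
        \<le> (norm (f p) + norm (g p)) * (1 + (norm (snd p))\<^sup>2) ^ N"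
      by (intro mult_right_mono norm_triangle_ineq) simp
    with C[of p] D[of p] show ?thesis by (simp add: distrib_right)
  qed
  then show "\<exists>C. \<forall>p. norm (f p + g p) * (1 + (norm (snd p))\<^sup>2) ^ N \<le> C" by blast
qed

lemma decays_mult:
  assumes "decays f" and q: "\<And>p. norm (q p) \<le> K * (1 + (norm (snd p))\<^sup>2) ^ M"
  shows "decays (\<lambda>p. q p * f p)"
  unfolding decays_def
proof
  fix N
  obtain C where C: "\<And>p. norm (f p) * (1 + (norm (snd p))\<^sup>2) ^ (N + M) \<le> C"
    using assms unfolding decays_def by metis
  \<comment> \<open>The growth bound on \<open>q\<close> at a single point forces \<open>K \<ge> 0\<close>.\<close>
  have "0 \<le> K * (1 + (norm (0::'b))\<^sup>2) ^ M"
    using q[of "(undefined, 0)"] norm_ge_zero order_trans by (metis snd_conv)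
  then have K: "K \<ge> 0" by simp
  have "norm (q p * f p) * (1 + (norm (snd p))\<^sup>2) ^ N \<le> K * C" for p
  proof -
    have "norm (q p * f p) * (1 + (norm (snd p))\<^sup>2) ^ N
        \<le> (K * (1 + (norm (snd p))\<^sup>2) ^ M * norm (f p)) * (1 + (norm (snd p))\<^sup>2) ^ N"
      using q[of p] by (auto simp: norm_mult intro!: mult_right_mono)
    also have "\<dots> = K * (norm (f p) * (1 + (norm (snd p))\<^sup>2) ^ (N + M))"
      by (simp add: power_add)
    also have "\<dots> \<le> K * C" using C[of p] K by (intro mult_left_mono)
    finally show ?thesis .
  qed
  then show "\<exists>C. \<forall>p. norm (q p * f p) * (1 + (norm (snd p))\<^sup>2) ^ N \<le> C" by blast
qed

lemma decays_cmult: "decays f \<Longrightarrow> decays (\<lambda>p. c * f p)"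
  by (rule decays_mult[of f "\<lambda>_. c" "norm c" 0]) auto

lemma abs_inner_le_one_plus_square:
  assumes "norm b = 1"
  shows "\<bar>x \<bullet> b\<bar> \<le> 1 + (norm x)\<^sup>2"
proof -
  have "\<bar>x \<bullet> b\<bar> \<le> norm x" using Cauchy_Schwarz_ineq2[of x b] assms by simp
  also have "\<dots> \<le> 1 + (norm x)\<^sup>2"
  proof -
    have "0 \<le> (norm x - 1)\<^sup>2 + (norm x)\<^sup>2 + 1" by simp
    then show ?thesis by (simp add: power2_eq_square algebra_simps)
  qed
  finally show ?thesis .
qed

lemma decays_mult_coord:
  assumes "decays f" "norm b = 1"
  shows "decays (\<lambda>p. of_real (snd p \<bullet> b) * f p)"
  using assms abs_inner_le_one_plus_square[of b]
  by (intro decays_mult[of f _ 1 1]) auto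

text \<open>The greatest class of continuous, fast decaying functions that is stable under partial
  derivatives. On \<open>T\<^sup>m \<times> R\<^sup>n\<close> its periodic members are the Schwartz functions, as
  \<open>schwartz_space_iff_rapid\<close> below shows.\<close>
coinductive rapid :: "('a::euclidean_space \<times> 'b::euclidean_space \<Rightarrow> complex) \<Rightarrow> bool" where
  rapidI: "continuous_on UNIV f \<Longrightarrow> decays f \<Longrightarrow>
    (\<forall>b\<in>Basis. (\<forall>p. (\<lambda>s::real. f (p + s *\<^sub>R b)) differentiable (at 0)) \<and> rapid (partial_deriv b f)) \<Longrightarrow>
    rapid f"

lemma rapidD:
  assumes "rapid f"
  shows "continuous_on UNIV f" "decays f" 
    "b \<in> Basis \<Longrightarrow> (\<lambda>s::real. f (p + s *\<^sub>R b)) differentiable (at 0)"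
    "b \<in> Basis \<Longrightarrow> rapid (partial_deriv b f)"
  using assms by (auto elim: rapid.cases)

lemma rapid_has_partial_deriv:
  assumes "rapid f" "b \<in> Basis"
  shows "((\<lambda>s. f (p + s *\<^sub>R b)) has_vector_derivative partial_deriv b f (p + s0 *\<^sub>R b)) (at s0)"
  using assms by (intro has_partial_deriv rapidD)

lemma rapid_has_partial_deriv0:
  assumes "rapid f" "b \<in> Basis"
  shows "((\<lambda>s. f (p + s *\<^sub>R b)) has_vector_derivative partial_deriv b f p) (at 0)"
  using rapid_has_partial_deriv[OF assms, of p 0] by simp

text \<open>The coinduction principle in the form in which it is used: the family \<open>X\<close> has to contain, with
  each function, a formula \<open>f'\<close> for its partial derivative. That \<open>f'\<close> is the function
  \<open>partial_deriv b f\<close> follows from uniqueness of derivatives.\<close>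
lemma rapid_coinduct_upto:
  assumes "X f"
    and "\<And>f. X f \<Longrightarrow> continuous_on UNIV f"
    and "\<And>f. X f \<Longrightarrow> decays f"
    and deriv: "\<And>f b. X f \<Longrightarrow> b \<in> Basis \<Longrightarrow>
      \<exists>f'. X f' \<and> (\<forall>p. ((\<lambda>s. f (p + s *\<^sub>R b)) has_vector_derivative f' p) (at 0))"
  shows "rapid f"
  using \<open>X f\<close>
proof (coinduction arbitrary: f rule: rapid.coinduct)
  case (rapid f)
  have "(\<forall>p. (\<lambda>s. f (p + s *\<^sub>R b)) differentiable at 0) \<and> X (partial_deriv b f)" if "b \<in> Basis" for b
  proof -
    obtain f' where f': "X f'" "\<And>p. ((\<lambda>s. f (p + s *\<^sub>R b)) has_vector_derivative f' p) (at 0)"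
      using deriv[OF \<open>X f\<close> \<open>b \<in> Basis\<close>] by blast
    from f'(2) have "partial_deriv b f = f'" by (intro ext partial_deriv_eqI)
    with f' show ?thesis by (auto intro: differentiableI_vector)
  qed
  with rapid assms(2,3) show ?case by auto
qed

lemma rapid_lincomb:
  fixes f g :: "'a::euclidean_space \<times> 'b::euclidean_space \<Rightarrow> complex"
  assumes "rapid f" "rapid g"
  shows "rapid (\<lambda>p. c * f p + d * g p)"
proof (rule rapid_coinduct_upto[where X = "\<lambda>h. \<exists>f g. rapid f \<and> rapid g \<and> h = (\<lambda>p. c * f p + d * g p)"])
  fix h :: "'a \<times> 'b \<Rightarrow> complex" and b :: "'a \<times> 'b"
  assume "\<exists>f g. rapid f \<and> rapid g \<and> h = (\<lambda>p. c * f p + d * g p)" and b: "b \<in> Basis"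
  then obtain f g where fg: "rapid f" "rapid g" and h: "h = (\<lambda>p. c * f p + d * g p)" by blast
  have "((\<lambda>s. h (p + s *\<^sub>R b)) has_vector_derivative c * partial_deriv b f p + d * partial_deriv b g p) (at 0)" for p
    unfolding h
    by (auto intro!: derivative_eq_intros has_vector_derivative_mult_right rapid_has_partial_deriv0 fg b)
  moreover have "\<exists>f' g'. rapid f' \<and> rapid g' \<and>
      (\<lambda>p. c * partial_deriv b f p + d * partial_deriv b g p) = (\<lambda>p. c * f' p + d * g' p)"
    using rapidD(4)[OF _ b] fg by blast
  ultimately show "\<exists>h'. (\<exists>f g. rapid f \<and> rapid g \<and> h' = (\<lambda>p. c * f p + d * g p)) \<and>
      (\<forall>p. ((\<lambda>s. h (p + s *\<^sub>R b)) has_vector_derivative h' p) (at 0))" by blast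
qed (use assms in \<open>auto dest: rapidD(1,2) intro!: continuous_intros decays_add decays_cmult\<close>)

lemma rapid_add: "rapid f \<Longrightarrow> rapid g \<Longrightarrow> rapid (\<lambda>p. f p + g p)"
  using rapid_lincomb[of f g 1 1] by simp

lemma rapid_cmult: "rapid f \<Longrightarrow> rapid (\<lambda>p. c * f p)"
  using rapid_lincomb[of f f c 0] by simp

lemma rapid_sum:
  assumes "finite I" "I \<noteq> {}" "\<And>i. i \<in> I \<Longrightarrow> rapid (f i)"
  shows "rapid (\<lambda>p. \<Sum>i\<in>I. f i p)"
  using assms by (induction I rule: finite_ne_induct) (auto intro!: rapid_add)

text \<open>The products \<open>x\<^sub>j u\<close> alone are not closed under differentiation, as the product rule adds a
  multiple of \<open>u\<close>. The sums \<open>x\<^sub>j u + v\<close> with \<open>u\<close> and \<open>v\<close> rapid are closed.\<close>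
lemma rapid_mult_coord:
  fixes f :: "'a::euclidean_space \<times> 'b::euclidean_space \<Rightarrow> complex"
  assumes "rapid f" and j: "j \<in> Basis"
  shows "rapid (\<lambda>p. of_real (snd p \<bullet> j) * f p)"
proof (rule rapid_coinduct_upto[where X = "\<lambda>h. \<exists>u v. rapid u \<and> rapid v \<and> h = (\<lambda>p. of_real (snd p \<bullet> j) * u p + v p)"])
  fix h :: "'a \<times> 'b \<Rightarrow> complex" and b :: "'a \<times> 'b"

  assume "\<exists>u v. rapid u \<and> rapid v \<and> h = (\<lambda>p. of_real (snd p \<bullet> j) * u p + v p)" and b: "b \<in> Basis"
  then obtain u v where uv: "rapid u" "rapid v" and h: "h = (\<lambda>p. of_real (snd p \<bullet> j) * u p + v p)" by blast
  let ?v = "\<lambda>p. of_real (snd b \<bullet> j) * u p + 1 * partial_deriv b v p"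
  have "((\<lambda>s. h (p + s *\<^sub>R b)) has_vector_derivative of_real (snd p \<bullet> j) * partial_deriv b u p + ?v p) (at 0)" for p
    unfolding h
    by (rule derivative_eq_intros has_vector_derivative_mult has_vector_derivative_of_real rapid_has_partial_deriv0 uv b refl | simp add: inner_add_left)+
  moreover have "rapid ?v" "rapid (partial_deriv b u)"
    using rapidD(4)[OF _ b] uv by (blast intro: rapid_lincomb)+
  ultimately show "\<exists>h'. (\<exists>u v. rapid u \<and> rapid v \<and> h' = (\<lambda>p. of_real (snd p \<bullet> j) * u p + v p)) \<and>
      (\<forall>p. ((\<lambda>s. h (p + s *\<^sub>R b)) has_vector_derivative h' p) (at 0))" by blast
next
  \<comment> \<open>Initially \<open>v\<close> is the zero function, which is rapid as a multiple of \<open>f\<close>.\<close>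
  have "rapid (\<lambda>p. 0 * f p)" using assms(1) by (rule rapid_cmult)
  with assms(1) show "\<exists>u v. rapid u \<and> rapid v \<and> (\<lambda>p. of_real (snd p \<bullet> j) * f p) = (\<lambda>p. of_real (snd p \<bullet> j) * u p + v p)"
    by (intro exI[of _ f] exI[of _ "\<lambda>p. 0 * f p"]) simp
qed (use j in \<open>auto dest: rapidD(1,2) intro!: continuous_intros decays_add decays_mult_coord\<close>)

lemma rapid_imp_C_k: "rapid f \<Longrightarrow> C_k k f"
  by (induction k arbitrary: f) (auto intro: rapidD)

lemma rapid_funpow_partial_deriv:
  "rapid f \<Longrightarrow> b \<in> Basis \<Longrightarrow> rapid ((partial_deriv b ^^ k) f)"
  by (induction k) (auto intro: rapidD)

lemma rapid_multi_deriv: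
  assumes "rapid f" "\<And>k. e k \<in> Basis"
  shows "rapid (multi_deriv e \<alpha> f)"
proof -
  have "rapid (foldr (\<lambda>k. partial_deriv (e k) ^^ \<alpha> k) ks f)" for ks
    by (induction ks) (auto intro: assms rapid_funpow_partial_deriv)
  then show ?thesis by (simp add: multi_deriv_def)
qed

section \<open>Commuting derivatives and Schwartz functions\<close>

definition smooth :: "('a::euclidean_space \<Rightarrow> complex) \<Rightarrow> bool" where
  "smooth f \<longleftrightarrow> (\<forall>k. C_k k f)"

lemma smoothD:
  assumes "smooth f"
  shows "continuous_on UNIV f"
    "b \<in> Basis \<Longrightarrow> (\<lambda>s::real. f (p + s *\<^sub>R b)) differentiable (at 0)"
    "b \<in> Basis \<Longrightarrow> smooth (partial_deriv b f)"
proof -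
  have *: "C_k (Suc k) f" for k using assms by (simp add: smooth_def del: C_k.simps)
  from *[of 0] show "continuous_on UNIV f" by simp
  from *[of 0] show "b \<in> Basis \<Longrightarrow> (\<lambda>s::real. f (p + s *\<^sub>R b)) differentiable (at 0)" by simp
  from * show "b \<in> Basis \<Longrightarrow> smooth (partial_deriv b f)" by (simp add: smooth_def)
qed

lemma smooth_has_partial_deriv:
  assumes "smooth f" "b \<in> Basis"
  shows "((\<lambda>s. f (p + s *\<^sub>R b)) has_vector_derivative partial_deriv b f (p + s0 *\<^sub>R b)) (at s0)"
  using assms by (intro has_partial_deriv smoothD)

text \<open>Clairaut's theorem. By the fundamental theorem of calculus
  \<open>f (p + s a) - f p\<close> is the integral of \<open>\<partial>\<^sub>a f\<close> over the segment. Differentiation under the integral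
  sign in the direction \<open>b\<close> gives \<open>\<partial>\<^sub>b f (p + s a) - \<partial>\<^sub>b f p\<close> as the integral of \<open>\<partial>\<^sub>b \<partial>\<^sub>a f\<close>, and the
  derivative of this in \<open>s\<close> at \<open>0\<close> is \<open>\<partial>\<^sub>b \<partial>\<^sub>a f p\<close>. Only \<open>s \<ge> 0\<close> is considered, since a one-sided
  derivative already determines the value.\<close>
lemma smooth_partial_deriv_commute:
  assumes f: "smooth f" and a: "a \<in> Basis" and b: "b \<in> Basis"
  shows "partial_deriv a (partial_deriv b f) = partial_deriv b (partial_deriv a f)"
proof
  fix p
  note cont = continuous_on_compose2[OF smoothD(1)]
  let ?ba = "partial_deriv b (partial_deriv a f)"
  have FTC: "f (q + s *\<^sub>R a) - f q = integral {0..s} (\<lambda>u. partial_deriv a f (q + u *\<^sub>R a))"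
    if "0 \<le> s" for s q
  proof -
    have "((\<lambda>u. partial_deriv a f (q + u *\<^sub>R a)) has_integral f (q + s *\<^sub>R a) - f (q + 0 *\<^sub>R a)) {0..s}"
      by (rule fundamental_theorem_of_calculus[OF that])
        (rule has_vector_derivative_at_within[OF smooth_has_partial_deriv[OF f a]])
    then show ?thesis by (simp add: integral_unique)
  qed
  have diff: "partial_deriv b f (p + s *\<^sub>R a) - partial_deriv b f p = integral {0..s} (\<lambda>u. ?ba (p + u *\<^sub>R a))"
    if s: "0 \<le> s" for s
  proof -
    have "((\<lambda>r. integral (cbox 0 s) (\<lambda>u. partial_deriv a f (p + r *\<^sub>R b + u *\<^sub>R a))) has_vector_derivative
        integral (cbox 0 s) (\<lambda>u. ?ba (p + 0 *\<^sub>R b + u *\<^sub>R a))) (at 0 within UNIV)"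
    proof (rule leibniz_rule_vector_derivative)
      fix r u :: real
      have "((\<lambda>r. partial_deriv a f (p + u *\<^sub>R a + r *\<^sub>R b)) has_vector_derivative ?ba (p + u *\<^sub>R a + r *\<^sub>R b)) (at r)"
        by (rule smooth_has_partial_deriv[OF smoothD(3)[OF f a] b])
      then show "((\<lambda>r. partial_deriv a f (p + r *\<^sub>R b + u *\<^sub>R a)) has_vector_derivative ?ba (p + r *\<^sub>R b + u *\<^sub>R a)) (at r within UNIV)"
        by (simp add: ac_simps)
    next
      fix r :: real
      show "(\<lambda>u. partial_deriv a f (p + r *\<^sub>R b + u *\<^sub>R a)) integrable_on cbox 0 s"
        by (intro integrable_continuous cont[OF smoothD(3)[OF f a]]) (auto intro!: continuous_intros)
    next
      show "continuous_on (UNIV \<times> cbox 0 s) (\<lambda>(r, u). ?ba (p + r *\<^sub>R b + u *\<^sub>R a))"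
        unfolding case_prod_beta
        by (intro cont[OF smoothD(3)[OF smoothD(3)[OF f a] b]]) (auto intro!: continuous_intros)
    qed auto
    then have "((\<lambda>r. f (p + r *\<^sub>R b + s *\<^sub>R a) - f (p + r *\<^sub>R b)) has_vector_derivative
        integral {0..s} (\<lambda>u. ?ba (p + u *\<^sub>R a))) (at 0)"
      by (simp add: FTC[OF s])
    moreover have "((\<lambda>r. f ((p + s *\<^sub>R a) + r *\<^sub>R b) - f (p + r *\<^sub>R b)) has_vector_derivative
        partial_deriv b f (p + s *\<^sub>R a) - partial_deriv b f p) (at 0)"
      using smooth_has_partial_deriv[OF f b, of "p + s *\<^sub>R a" 0] smooth_has_partial_deriv[OF f b, of p 0]
      by (intro has_vector_derivative_diff) simp_all
    then have "((\<lambda>r. f (p + r *\<^sub>R b + s *\<^sub>R a) - f (p + r *\<^sub>R b)) has_vector_derivative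
        partial_deriv b f (p + s *\<^sub>R a) - partial_deriv b f p) (at 0)"
      by (simp add: ac_simps)
    ultimately show ?thesis by (rule vector_derivative_unique_at[symmetric])
  qed
  have "((\<lambda>s. integral {0..s} (\<lambda>u. ?ba (p + u *\<^sub>R a))) has_vector_derivative ?ba (p + 0 *\<^sub>R a)) (at 0 within {0..1})"
    by (rule integral_has_vector_derivative[where f = "\<lambda>u. ?ba (p + u *\<^sub>R a)"])
      (auto intro!: continuous_intros cont[OF smoothD(3)[OF smoothD(3)[OF f a] b]])
  then have D: "((\<lambda>s. integral {0..s} (\<lambda>u. ?ba (p + u *\<^sub>R a))) has_vector_derivative ?ba p) (at 0 within {0..1})"
    by simp
  have "((\<lambda>s. partial_deriv b f (p + s *\<^sub>R a) - partial_deriv b f p) has_vector_derivative ?ba p) (at 0 within {0..1})"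
    by (rule has_vector_derivative_transform[OF _ _ D]) (auto simp: diff)
  moreover have "((\<lambda>s. partial_deriv b f (p + s *\<^sub>R a) - partial_deriv b f p) has_vector_derivative
      partial_deriv a (partial_deriv b f) p) (at 0 within {0..1})"
    using has_vector_derivative_diff_const[of "\<lambda>s. partial_deriv b f (p + s *\<^sub>R a)" "partial_deriv b f p"]
      smooth_has_partial_deriv[OF smoothD(3)[OF f b] a, of p 0]
    by (simp add: has_vector_derivative_at_within)
  ultimately show "partial_deriv a (partial_deriv b f) p = ?ba p"
    by (intro vector_derivative_unique_within) (auto simp: at_within_Icc_at_right)
qed

text \<open>Iterated derivatives along arbitrary lists of directions forget the multi-index structure;
  for smooth functions they depend only on the multiset of directions.\<close>
definition iterated_deriv :: "'a::euclidean_space list \<Rightarrow> ('a \<Rightarrow> complex) \<Rightarrow> 'a \<Rightarrow> complex" where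
  "iterated_deriv bs = foldr partial_deriv bs"

lemma iterated_deriv_simps [simp]:
  "iterated_deriv [] f = f"
  "iterated_deriv (b # bs) f = partial_deriv b (iterated_deriv bs f)"
  "iterated_deriv (as @ bs) f = iterated_deriv as (iterated_deriv bs f)"
  by (simp_all add: iterated_deriv_def)

lemma smooth_iterated_deriv: "smooth f \<Longrightarrow> set bs \<subseteq> Basis \<Longrightarrow> smooth (iterated_deriv bs f)"
  by (induction bs) (auto intro: smoothD)

lemma iterated_deriv_pull_out:
  assumes "smooth f" "set bs \<subseteq> Basis" "b \<in> Basis"
  shows "iterated_deriv bs (partial_deriv b f) = partial_deriv b (iterated_deriv bs f)"
  using assms(2)
proof (induction bs)
  case (Cons a bs)
  then have "partial_deriv a (partial_deriv b (iterated_deriv bs f)) = partial_deriv b (partial_deriv a (iterated_deriv bs f))"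
    by (intro smooth_partial_deriv_commute smooth_iterated_deriv assms(1,3)) auto
  with Cons show ?case by simp
qed simp

lemma iterated_deriv_cong_mset:
  assumes "smooth f" "mset as = mset bs" "set as \<subseteq> Basis"
  shows "iterated_deriv as f = iterated_deriv bs f"
  using assms(2,3)
proof (induction as arbitrary: bs)
  case (Cons a as)
  then have "a \<in> set bs" by (metis list.set_intros(1) mset_eq_setD)
  then obtain xs ys where bs: "bs = xs @ a # ys" by (meson split_list)
  have "set bs \<subseteq> Basis" using Cons.prems by (metis mset_eq_setD)
  with bs have "set xs \<subseteq> Basis" "set ys \<subseteq> Basis" "a \<in> Basis" by auto
  then have "iterated_deriv bs f = partial_deriv a (iterated_deriv (xs @ ys) f)"
    using assms(1) by (simp add: bs iterated_deriv_pull_out smooth_iterated_deriv)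
  also have "iterated_deriv (xs @ ys) f = iterated_deriv as f"
    using Cons bs by (intro Cons.IH[symmetric]) auto
  finally show ?case by simp
qed simp

definition multi_index_list :: "('k::finite \<Rightarrow> 'a) \<Rightarrow> ('k \<Rightarrow> nat) \<Rightarrow> 'a list" where
  "multi_index_list e \<alpha> = concat (map (\<lambda>k. replicate (\<alpha> k) (e k)) index_list)"

lemma multi_deriv_eq_iterated_deriv:
  fixes f :: "'a::euclidean_space \<Rightarrow> complex"
  shows "multi_deriv e \<alpha> f = iterated_deriv (multi_index_list e \<alpha>) f"
proof -
  have *: "iterated_deriv (replicate n b) g = (partial_deriv b ^^ n) g" for n b and g :: "'a \<Rightarrow> complex"
    by (induction n) auto
  have "foldr (\<lambda>k. partial_deriv (e k) ^^ \<alpha> k) ks f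
      = iterated_deriv (concat (map (\<lambda>k. replicate (\<alpha> k) (e k)) ks)) f" for ks
    by (induction ks) (auto simp: *)
  then show ?thesis by (simp add: multi_deriv_def multi_index_list_def)
qed

lemma count_multi_index_list:
  fixes e :: "'k::finite \<Rightarrow> 'a"
  shows "count (mset (multi_index_list e \<alpha>)) b = (\<Sum>k | e k = b. \<alpha> k)"
proof -
  have "count (mset (concat (map (\<lambda>k. replicate (\<alpha> k) (e k)) ks))) b = (\<Sum>k\<in>{k\<in>set ks. e k = b}. \<alpha> k)"
    if "distinct ks" for ks
    using that
  proof (induction ks)
    case (Cons k ks)
    show ?case
    proof (cases "e k = b")
      case True
      then have "{k'\<in>set (k # ks). e k' = b} = insert k {k'\<in>set ks. e k' = b}" by auto
      with True Cons show ?thesis by simp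
    next
      case False
      then have "{k'\<in>set (k # ks). e k' = b} = {k'\<in>set ks. e k' = b}" by auto
      with False Cons show ?thesis by simp
    qed
  qed simp
  from this[OF index_list(1)] show ?thesis by (simp add: multi_index_list_def index_list(2))
qed

lemma basis_vectors_prod_cart:
  "(Basis :: ((real^'m) \<times> (real^'n)) set) = range (\<lambda>i. (axis i 1, 0)) \<union> range (\<lambda>j. (0, axis j 1))"
  by (auto simp: Basis_prod_def Basis_vec_def)

text \<open>The multi-indices count how often each axis occurs among the directions.\<close>
lemma iterated_deriv_eq_multi_deriv:
  fixes f :: "(real^'m) \<times> (real^'n) \<Rightarrow> complex"
  assumes "smooth f" "set bs \<subseteq> Basis"
  shows "\<exists>\<alpha> \<beta>. iterated_deriv bs f = deriv_t \<alpha> (deriv_x \<beta> f)"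
proof -
  let ?et = "\<lambda>i::'m. (axis i 1 :: real^'m, 0 :: real^'n)" and ?ex = "\<lambda>j::'n. (0 :: real^'m, axis j 1 :: real^'n)"
  define \<alpha> \<beta> where "\<alpha> i = count (mset bs) (?et i)" and "\<beta> j = count (mset bs) (?ex j)" for i j
  have t: "(\<Sum>i | ?et i = b. \<alpha> i) = (if b \<in> range ?et then count (mset bs) b else 0)" for b
  proof (cases "b \<in> range ?et")
    case True
    then obtain i where b: "b = ?et i" by blast
    then have "{i. ?et i = b} = {i}" by (auto simp: axis_eq_axis)
    with b show ?thesis by (simp add: \<alpha>_def)
  next
    case False
    then have "{i. ?et i = b} = {}" by auto
    with False show ?thesis by auto
  qed
  have x: "(\<Sum>j | ?ex j = b. \<beta> j) = (if b \<in> range ?ex then count (mset bs) b else 0)" for b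
  proof (cases "b \<in> range ?ex")
    case True
    then obtain j where b: "b = ?ex j" by blast
    then have "{j. ?ex j = b} = {j}" by (auto simp: axis_eq_axis)
    with b show ?thesis by (simp add: \<beta>_def)
  next
    case False
    then have "{j. ?ex j = b} = {}" by auto
    with False show ?thesis by auto
  qed
  have disj: "range ?et \<inter> range ?ex = {}" by (auto simp: axis_eq_0_iff)
  have "mset (multi_index_list ?et \<alpha> @ multi_index_list ?ex \<beta>) = mset bs"
  proof (rule multiset_eqI)
    fix b
    have "count (mset bs) b = 0" if "b \<notin> range ?et \<union> range ?ex"
      using assms(2) that basis_vectors_prod_cart by (auto simp: count_mset_0_iff)
    then show "count (mset (multi_index_list ?et \<alpha> @ multi_index_list ?ex \<beta>)) b = count (mset bs) b"
      using disj by (auto simp: count_multi_index_list t x)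
  qed
  from iterated_deriv_cong_mset[OF assms(1) this[symmetric] assms(2)]
  have "iterated_deriv bs f = deriv_t \<alpha> (deriv_x \<beta> f)"
    by (simp add: deriv_t_def deriv_x_def multi_deriv_eq_iterated_deriv)
  then show ?thesis by blast
qed

text \<open>Decay of the derivatives \<open>\<partial>\<^sub>t\<^sup>\<alpha> \<partial>\<^sub>x\<^sup>\<beta> f\<close> is enough, because these are all the iterated partial
  derivatives of \<open>f\<close>.\<close>
lemma rapidI_multi_deriv:
  fixes f :: "(real^'m) \<times> (real^'n) \<Rightarrow> complex"
  assumes "smooth f" "\<And>\<alpha> \<beta>. decays (deriv_t \<alpha> (deriv_x \<beta> f))"
  shows "rapid f"
proof (rule rapid_coinduct_upto[where X = "\<lambda>g. \<exists>bs. set bs \<subseteq> Basis \<and> g = iterated_deriv bs f"])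
  show "\<exists>bs. set bs \<subseteq> Basis \<and> f = iterated_deriv bs f" by (intro exI[of _ "[]"]) simp
next
  fix g assume "\<exists>bs. set bs \<subseteq> Basis \<and> g = iterated_deriv bs f"
  then show "continuous_on UNIV g" using assms(1) smooth_iterated_deriv smoothD(1) by blast
next
  fix g assume "\<exists>bs. set bs \<subseteq> Basis \<and> g = iterated_deriv bs f"
  then show "decays g" using iterated_deriv_eq_multi_deriv[OF assms(1)] assms(2) by metis
next
  fix g and b :: "(real^'m) \<times> (real^'n)"
  assume "\<exists>bs. set bs \<subseteq> Basis \<and> g = iterated_deriv bs f" and b: "b \<in> Basis"
  then obtain bs where bs: "set bs \<subseteq> Basis" "g = iterated_deriv bs f" by blast
  then have "((\<lambda>s. g (p + s *\<^sub>R b)) has_vector_derivative iterated_deriv (b # bs) f p) (at 0)" for p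
    using smooth_has_partial_deriv[OF smooth_iterated_deriv[OF assms(1) bs(1)] b, of p 0] by simp
  moreover have "set (b # bs) \<subseteq> Basis" using b bs by simp
  ultimately show "\<exists>g'. (\<exists>bs. set bs \<subseteq> Basis \<and> g' = iterated_deriv bs f) \<and>
      (\<forall>p. ((\<lambda>s. g (p + s *\<^sub>R b)) has_vector_derivative g' p) (at 0))" by blast
qed

lemma rapid_deriv_t_deriv_x:
  fixes f :: "(real^'m) \<times> (real^'n) \<Rightarrow> complex"
  assumes "rapid f"
  shows "rapid (deriv_t \<alpha> (deriv_x \<beta> f))"
  unfolding deriv_t_def deriv_x_def using assms
  by (intro rapid_multi_deriv) (auto simp: basis_vectors_prod_cart)

text \<open>The hypothesis is inherited by \<open>(1 + \<bar>x\<bar>\<^sup>2) u\<close>, since \<open>x\<^sup>\<gamma> \<bar>x\<bar>\<^sup>2\<close> is a sum of monomials. This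
  gives an induction over the exponent that never expands \<open>(1 + \<bar>x\<bar>\<^sup>2)\<^sup>N\<close>.\<close>
lemma bounded_monomials_imp_decays:
  fixes u :: "'a \<times> (real^'n) \<Rightarrow> complex"
  assumes "\<And>\<gamma>. \<exists>C. \<forall>p. norm (of_real (monomial \<gamma> (snd p)) * u p) \<le> C"
  shows "decays u"
  unfolding decays_def
proof
  fix N
  show "\<exists>C. \<forall>p. norm (u p) * (1 + (norm (snd p))\<^sup>2) ^ N \<le> C"
    using assms
  proof (induction N arbitrary: u)
    case 0
    from 0[of "\<lambda>_. 0"] show ?case by (auto simp: monomial_def)
  next
    case (Suc N)
    let ?v = "\<lambda>p. of_real (1 + (norm (snd p))\<^sup>2) * u p"
    have "\<exists>C. \<forall>p. norm (of_real (monomial \<gamma> (snd p)) * ?v p) \<le> C" for \<gamma>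
    proof -
      have sq: "monomial \<gamma> x * (norm x)\<^sup>2 = (\<Sum>j\<in>UNIV. monomial (\<gamma>(j := \<gamma> j + 2)) x)" for x
      proof -
        have "monomial (\<gamma>(j := \<gamma> j + 2)) x = monomial \<gamma> x * (x $ j)\<^sup>2" for j
        proof -
          have "monomial (\<gamma>(j := \<gamma> j + 2)) x = (\<Prod>i\<in>UNIV. (x $ i) ^ \<gamma> i * (if i = j then (x $ j)\<^sup>2 else 1))"
            unfolding monomial_def by (intro prod.cong) (auto simp: power_add power2_eq_square)
          also have "\<dots> = monomial \<gamma> x * (x $ j)\<^sup>2"
            unfolding monomial_def prod.distrib by simp
          finally show ?thesis .
        qed
        moreover have "(norm x)\<^sup>2 = (\<Sum>j\<in>UNIV. (x $ j)\<^sup>2)"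
          by (simp add: norm_vec_def L2_set_def sum_nonneg)
        ultimately show ?thesis by (simp add: sum_distrib_left)
      qed
      obtain C where C: "\<And>\<gamma> p. norm (of_real (monomial \<gamma> (snd p)) * u p) \<le> C \<gamma>"
        using Suc.prems by metis
      have "norm (of_real (monomial \<gamma> (snd p)) * ?v p) \<le> C \<gamma> + (\<Sum>j\<in>UNIV. C (\<gamma>(j := \<gamma> j + 2)))" for p
      proof -
        have "of_real (monomial \<gamma> (snd p)) * ?v p = of_real (monomial \<gamma> (snd p) * (1 + (norm (snd p))\<^sup>2)) * u p"
          by simp
        also have "\<dots> = of_real (monomial \<gamma> (snd p)) * u p
            + (\<Sum>j\<in>UNIV. of_real (monomial (\<gamma>(j := \<gamma> j + 2)) (snd p)) * u p)"
          by (simp only: distrib_left sq) (simp add: distrib_right sum_distrib_right)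
        finally show ?thesis
          by (auto intro!: norm_triangle_mono C order_trans[OF norm_sum] sum_mono)
      qed
      then show ?thesis by blast
    qed
    from Suc.IH[of ?v, OF this] show ?case
      by (auto simp: norm_mult mult_ac abs_of_nonneg add_nonneg_nonneg simp del: of_real_add)
  qed
qed

lemma abs_monomial_le: "\<bar>monomial \<gamma> x\<bar> \<le> (1 + (norm x)\<^sup>2) ^ (\<Sum>j\<in>UNIV. \<gamma> j)"
  for x :: "real^'n"
proof -
  have "\<bar>monomial \<gamma> x\<bar> = (\<Prod>j\<in>UNIV. \<bar>x \<bullet> axis j 1\<bar> ^ \<gamma> j)"
    by (simp add: monomial_def abs_prod power_abs inner_axis)
  also have "\<dots> \<le> (\<Prod>j\<in>UNIV. (1 + (norm x)\<^sup>2) ^ \<gamma> j)"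
    by (intro prod_mono conjI power_mono abs_inner_le_one_plus_square) auto
  also have "\<dots> = (1 + (norm x)\<^sup>2) ^ (\<Sum>j\<in>UNIV. \<gamma> j)"
    by (simp add: power_sum)
  finally show ?thesis .
qed

lemma decays_imp_bounded: "decays f \<Longrightarrow> \<exists>C. \<forall>p. norm (f p) \<le> C"
  unfolding decays_def by (drule spec[of _ 0]) simp

lemma SUP_ennreal_finite_iff:
  "(SUP p\<in>UNIV. ennreal (h p)) < \<infinity> \<longleftrightarrow> (\<exists>C. \<forall>p. h p \<le> C)" if "\<And>p. 0 \<le> h p"
proof
  assume less: "(SUP p\<in>UNIV. ennreal (h p)) < \<infinity>"
  have "h p \<le> enn2real (SUP p\<in>UNIV. ennreal (h p))" for p
  proof -
    have "ennreal (h p) \<le> (SUP p\<in>UNIV. ennreal (h p))" by (rule SUP_upper) simp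
    also have "\<dots> = ennreal (enn2real (SUP p\<in>UNIV. ennreal (h p)))" using less by simp
    finally show ?thesis by (simp add: ennreal_le_iff)
  qed
  then show "\<exists>C. \<forall>p. h p \<le> C" by blast
next
  assume "\<exists>C. \<forall>p. h p \<le> C"
  then obtain C where "\<And>p. h p \<le> C" by blast
  then have "(SUP p\<in>UNIV. ennreal (h p)) \<le> ennreal C" by (intro SUP_least) (auto intro: ennreal_leI)
  also have "\<dots> < \<infinity>" by simp
  finally show "(SUP p\<in>UNIV. ennreal (h p)) < \<infinity>" .
qed

lemma schwartz_seminorm_finite_iff:
  "schwartz_seminorm \<alpha> \<beta> \<gamma> f < \<infinity> \<longleftrightarrow>
    (\<exists>C. \<forall>p. norm (of_real (monomial \<gamma> (snd p)) * deriv_t \<alpha> (deriv_x \<beta> f) p) \<le> C)"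
  unfolding schwartz_seminorm_def case_prod_unfold prod.collapse
  by (rule SUP_ennreal_finite_iff) simp

lemma schwartz_space_iff_rapid:
  "f \<in> schwartz_space \<longleftrightarrow> torus_periodic f \<and> rapid f"
proof
  assume f: "f \<in> schwartz_space"
  then have "smooth f" "torus_periodic f" by (auto simp: schwartz_space_def smooth_torus_def smooth_def)
  moreover have "decays (deriv_t \<alpha> (deriv_x \<beta> f))" for \<alpha> \<beta>
    using f by (intro bounded_monomials_imp_decays schwartz_seminorm_finite_iff[THEN iffD1])
      (simp add: schwartz_space_def)
  ultimately show "torus_periodic f \<and> rapid f" by (auto intro: rapidI_multi_deriv)
next
  assume f: "torus_periodic f \<and> rapid f"
  have "schwartz_seminorm \<alpha> \<beta> \<gamma> f < \<infinity>" for \<alpha> \<beta> \<gamma>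
    unfolding schwartz_seminorm_finite_iff
    using f by (intro decays_imp_bounded decays_mult[of _ _ 1 "\<Sum>j\<in>UNIV. \<gamma> j"] rapidD(2) rapid_deriv_t_deriv_x)
      (auto intro: abs_monomial_le)
  with f show "f \<in> schwartz_space"
    by (auto simp: schwartz_space_def smooth_torus_def rapid_imp_C_k)
qed

text \<open>Natural and real exponents give the same notion of fast decay. A natural number above \<open>N / 2\<close>
  serves in one direction. In the other the exponent \<open>2 N + 2\<close>, which yields one power more than
  required, is used instead of \<open>2 N\<close>, because the exponent has to be positive also for \<open>N = 0\<close>.\<close>
lemma decays_iff_powr:
  "decays f \<longleftrightarrow> (\<forall>N>0. \<exists>C>0. \<forall>p. norm (f p) \<le> C * (1 + (norm (snd p))\<^sup>2) powr (- N / 2))"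
proof (intro iffI allI impI)
  fix N :: real assume "decays f" "N > 0"
  obtain M :: nat where M: "N / 2 \<le> real M" using real_arch_simple by blast
  obtain C where C: "\<And>p. norm (f p) * (1 + (norm (snd p))\<^sup>2) ^ M \<le> C"
    using \<open>decays f\<close> unfolding decays_def by metis
  have "norm (f p) \<le> (\<bar>C\<bar> + 1) * (1 + (norm (snd p))\<^sup>2) powr (- N / 2)" for p
  proof -
    let ?r = "1 + (norm (snd p))\<^sup>2"
    have r: "?r \<ge> 1" by simp
    have "norm (f p) * ?r powr (N / 2) \<le> norm (f p) * ?r powr (real M)"
      using r M by (intro mult_left_mono powr_mono) auto
    also have "\<dots> \<le> \<bar>C\<bar> + 1" using C[of p] by (subst powr_realpow) (auto intro: add_pos_nonneg)
    finally have "norm (f p) * ?r powr (N / 2) * ?r powr (- N / 2) \<le> (\<bar>C\<bar> + 1) * ?r powr (- N / 2)"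
      by (intro mult_right_mono) auto
    moreover have "?r powr (N / 2) * ?r powr (- N / 2) = 1"
      using r by (auto simp: powr_add[symmetric] add_nonneg_eq_0_iff)
    ultimately show ?thesis by (simp add: mult.assoc)
  qed
  then show "\<exists>C>0. \<forall>p. norm (f p) \<le> C * (1 + (norm (snd p))\<^sup>2) powr (- N / 2)"
    by (intro exI[of _ "\<bar>C\<bar> + 1"]) auto
next
  assume R: "\<forall>N>0. \<exists>C>0. \<forall>p. norm (f p) \<le> C * (1 + (norm (snd p))\<^sup>2) powr (- N / 2)"
  show "decays f"
    unfolding decays_def
  proof
    fix N :: nat
    obtain C where C: "C > 0" "\<And>p. norm (f p) \<le> C * (1 + (norm (snd p))\<^sup>2) powr (- real (2 * N + 2) / 2)"
      using R[rule_format, of "real (2 * N + 2)"] by auto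
    have "norm (f p) * (1 + (norm (snd p))\<^sup>2) ^ N \<le> C" for p
    proof -
      let ?r = "1 + (norm (snd p))\<^sup>2"
      have r: "?r \<ge> 1" by simp
      have "norm (f p) * ?r ^ N \<le> C * ?r powr (- real (2 * N + 2) / 2) * ?r powr (real N)"
        using C(2)[of p] by (subst powr_realpow) (auto intro!: mult_right_mono add_pos_nonneg)
      also have "\<dots> = C * ?r powr (- 1)"
        by (simp add: mult.assoc powr_add[symmetric] field_simps)
      also have "\<dots> \<le> C * 1" using r C(1) by (intro mult_left_mono) (auto simp: powr_minus inverse_le_1_iff)
      finally show ?thesis by simp
    qed
    then show "\<exists>C. \<forall>p. norm (f p) * (1 + (norm (snd p))\<^sup>2) ^ N \<le> C" by blast
  qed
qed

section \<open>The partial Fourier transform of functions of rapid decay\<close>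

text \<open>Lebesgue measure on a Euclidean space is the image of the product of one-dimensional Lebesgue
  measures, so integrals of products of functions of the single coordinates factor.\<close>
lemma
  fixes f :: "'a::euclidean_space \<Rightarrow> real \<Rightarrow> 'c::{real_normed_field, banach, second_countable_topology}"
  assumes "\<And>b. b \<in> Basis \<Longrightarrow> integrable lborel (f b)"
  shows integrable_lborel_prod: "integrable lborel (\<lambda>x. \<Prod>b\<in>Basis. f b (x \<bullet> b))" (is ?I)
    and integral_lborel_prod: "(LINT x|lborel. (\<Prod>b\<in>Basis. f b (x \<bullet> b))) = (\<Prod>b\<in>Basis. (LINT x|lborel. f b x))" (is ?E)
proof -
  interpret product_sigma_finite "\<lambda>_::'a. lborel :: real measure" ..
  let ?g = "\<lambda>x. \<Prod>b\<in>Basis. f b (x \<bullet> b)"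
  have f[measurable]: "f b \<in> borel_measurable borel" if "b \<in> Basis" for b
    using borel_measurable_integrable[OF assms[OF that]] by simp
  have g: "?g \<in> borel_measurable borel" by measurable
  have *: "(\<lambda>f. \<Sum>b\<in>Basis. f b *\<^sub>R b) \<in> (\<Pi>\<^sub>M b\<in>(Basis::'a set). lborel) \<rightarrow>\<^sub>M borel"
    by measurable
  have eq: "?g (\<Sum>b\<in>Basis. h b *\<^sub>R b) = (\<Prod>b\<in>Basis. f b (h b))" for h
    by (intro prod.cong) auto
  show ?I
    by (subst lborel_eq, subst integrable_distr_eq[OF * g])
      (unfold eq, intro product_integrable_prod assms finite_Basis)
  show ?E
    by (subst lborel_eq, subst integral_distr[OF * g])
      (unfold eq, intro product_integral_prod assms finite_Basis)
qed

text \<open>An integrable function that dominates every rapid function up to a constant: since each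
  \<open>1 + (x \<bullet> b)\<^sup>2\<close> is at most \<open>1 + \<bar>x\<bar>\<^sup>2\<close>, one factor \<open>1 + \<bar>x\<bar>\<^sup>2\<close> per dimension suffices.\<close>
definition weight :: "'b::euclidean_space \<Rightarrow> real" where
  "weight x = inverse ((1 + (norm x)\<^sup>2) ^ DIM('b))"

lemma weight_pos: "0 < weight x"
  unfolding weight_def by (intro positive_imp_inverse_positive one_plus_square_pos(1))

lemma weight_nonneg: "0 \<le> weight x"
  using weight_pos[of x] by simp

lemma integrable_weight: "integrable lborel (weight :: 'b::euclidean_space \<Rightarrow> real)"
proof (rule Bochner_Integration.integrable_bound)
  have "integrable lborel (\<lambda>x::real. inverse (1 + x\<^sup>2))"
    using integrable_inverse_1_plus_square by (simp add: set_integrable_def)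
  then show "integrable lborel (\<lambda>x::'b. \<Prod>b\<in>Basis. inverse (1 + (x \<bullet> b)\<^sup>2))"
    by (rule integrable_lborel_prod)
  show "weight \<in> borel_measurable lborel" unfolding weight_def by measurable
  have "weight x \<le> (\<Prod>b\<in>Basis. inverse (1 + (x \<bullet> b)\<^sup>2))" for x :: 'b
  proof -
    have "weight x = (\<Prod>b\<in>(Basis::'b set). inverse (1 + (norm x)\<^sup>2))"
      by (simp add: weight_def power_inverse)
    also have "\<dots> \<le> (\<Prod>b\<in>Basis. inverse (1 + (x \<bullet> b)\<^sup>2))"
    proof (intro prod_mono conjI le_imp_inverse_le add_left_mono)
      fix b :: 'b assume "b \<in> Basis"
      then show "(x \<bullet> b)\<^sup>2 \<le> (norm x)\<^sup>2"
        using Basis_le_norm[of b x] by (simp add: abs_le_square_iff[symmetric])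
    qed (auto intro: add_pos_nonneg)
    finally show ?thesis .
  qed
  then show "AE x::'b in lborel. norm (weight x) \<le> norm (\<Prod>b\<in>Basis. inverse (1 + (x \<bullet> b)\<^sup>2))"
    by (intro AE_I2) (simp add: weight_nonneg prod_nonneg)
qed

text \<open>All translates of a rapid function by vectors of length at most \<open>1\<close> are thereby dominated by
  one integrable function, which is needed to differentiate a translated integral.\<close>
lemma weight_translate_le:
  fixes x :: "'b::euclidean_space"
  assumes "norm v \<le> 1"
  shows "weight (x + v) \<le> 3 ^ DIM('b) * weight x"
proof -
  have "norm x \<le> norm (x + v) + 1" using norm_triangle_ineq4[of "x + v" v] assms by simp
  then have "(norm x)\<^sup>2 \<le> (norm (x + v) + 1)\<^sup>2" by (intro power_mono) auto
  also have "\<dots> \<le> 2 * (norm (x + v))\<^sup>2 + 2"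
    using zero_le_power2[of "norm (x + v) - 1"] by (simp add: power2_eq_square algebra_simps)
  finally have le: "(norm x)\<^sup>2 \<le> 2 * (norm (x + v))\<^sup>2 + 2" .
  have "1 + a \<le> 3 * (1 + b)" if "a \<le> 2 * b + 2" "0 \<le> b" for a b :: real
    using that by (argo | simp add: algebra_simps | smt (verit))
  from this[OF le] have "1 + (norm x)\<^sup>2 \<le> 3 * (1 + (norm (x + v))\<^sup>2)"
    by simp
  then have "(1 + (norm x)\<^sup>2) ^ DIM('b) \<le> 3 ^ DIM('b) * (1 + (norm (x + v))\<^sup>2) ^ DIM('b)"
    unfolding power_mult_distrib[symmetric] by (intro power_mono) auto
  then have "inverse (3 ^ DIM('b) * (1 + (norm (x + v))\<^sup>2) ^ DIM('b)) \<le> weight x"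
    unfolding weight_def by (rule le_imp_inverse_le) (rule one_plus_square_pos(1))
  then have "3 ^ DIM('b) * inverse (3 ^ DIM('b) * (1 + (norm (x + v))\<^sup>2) ^ DIM('b)) \<le> 3 ^ DIM('b) * weight x"
    by (rule mult_left_mono) simp
  then show ?thesis by (simp add: weight_def inverse_mult_distrib mult.assoc[symmetric])
qed

lemma decays_le_weight:
  fixes f :: "'a \<times> 'b::euclidean_space \<Rightarrow> complex"
  assumes "decays f"
  shows "\<exists>C\<ge>0. \<forall>t x. norm (f (t, x)) \<le> C * weight x"
proof -
  obtain C where C: "\<And>p. norm (f p) * (1 + (norm (snd p))\<^sup>2) ^ DIM('b) \<le> C"
    using assms unfolding decays_def by metis
  have "norm (f (t, x)) \<le> C * weight x" for t x
    using C[of "(t, x)"] unfolding weight_def divide_inverse[symmetric]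
    by (subst pos_le_divide_eq[OF one_plus_square_pos(1)]) simp
  moreover have "0 \<le> C"
    using order_trans[OF _ C[of "(undefined, 0)"], of 0] by simp
  ultimately show ?thesis by blast
qed

lemma has_vector_derivative_at_0_iff:
  fixes f :: "real \<Rightarrow> 'c::real_normed_vector"
  shows "(f has_vector_derivative D) (at 0) \<longleftrightarrow> ((\<lambda>s. (f s - f 0) /\<^sub>R s) \<longlongrightarrow> D) (at 0)"
proof -
  have "((\<lambda>s. (f s - f 0) /\<^sub>R s) \<longlongrightarrow> D) (at 0) \<longleftrightarrow> ((\<lambda>s. norm ((f s - f 0) /\<^sub>R s - D)) \<longlongrightarrow> 0) (at 0)"
    by (simp only: LIM_zero_iff[symmetric, of _ D] tendsto_norm_zero_iff)
  also have "\<dots> \<longleftrightarrow> ((\<lambda>s. norm (f s - f 0 - s *\<^sub>R D) / norm s) \<longlongrightarrow> 0) (at 0)"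
  proof (rule filterlim_cong[OF refl refl])
    have "norm ((f s - f 0) /\<^sub>R s - D) = norm (f s - f 0 - s *\<^sub>R D) / norm s" if "s \<noteq> 0" for s
    proof -
      have "(f s - f 0) /\<^sub>R s - D = (f s - f 0 - s *\<^sub>R D) /\<^sub>R s"
        using that by (simp add: scaleR_diff_right)
      then show ?thesis by (simp add: divide_inverse mult.commute)
    qed
    then show "\<forall>\<^sub>F s in at 0. norm ((f s - f 0) /\<^sub>R s - D) = norm (f s - f 0 - s *\<^sub>R D) / norm s"
      by (simp add: eventually_at_filter)
  qed
  finally show ?thesis
    by (simp add: has_vector_derivative_def has_derivative_iff_norm bounded_linear_scaleR_left)
qed

text \<open>Differentiation under the integral sign. The mean value inequality bounds the difference
  quotients by \<open>w\<close>, and dominated convergence applies along every sequence tending to \<open>0\<close>.\<close>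
lemma has_vector_derivative_integral:
  fixes \<phi> \<psi> :: "real \<Rightarrow> 'x \<Rightarrow> 'c::{banach, second_countable_topology}"
  assumes int: "\<And>s. integrable M (\<phi> s)"
    and deriv: "\<And>s x. ((\<lambda>s. \<phi> s x) has_vector_derivative \<psi> s x) (at s)"
    and bound: "\<And>s x. \<bar>s\<bar> \<le> 1 \<Longrightarrow> norm (\<psi> s x) \<le> w x"
    and w: "integrable M w"
    and meas: "\<psi> 0 \<in> borel_measurable M"
  shows "((\<lambda>s. LINT x|M. \<phi> s x) has_vector_derivative (LINT x|M. \<psi> 0 x)) (at 0)"
proof -
  let ?q = "\<lambda>s x. (\<phi> s x - \<phi> 0 x) /\<^sub>R s"
  have lim: "((\<lambda>s. ?q s x) \<longlongrightarrow> \<psi> 0 x) (at 0)" for x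
    using deriv[where s = 0 and x = x] by (simp add: has_vector_derivative_at_0_iff)
  have q_bound: "norm (?q s x) \<le> w x" if s: "\<bar>s\<bar> < 1" "s \<noteq> 0" for s x
  proof -
    have "norm (\<phi> s x - \<phi> 0 x) \<le> w x * norm (s - 0)"
    proof (rule differentiable_bound[where S = "{-1..1}" and f' = "\<lambda>s h. h *\<^sub>R \<psi> s x"])
      show "((\<lambda>s. \<phi> s x) has_derivative (\<lambda>h. h *\<^sub>R \<psi> r x)) (at r within {-1..1})" for r
        using deriv[where s = r and x = x] by (simp add: has_vector_derivative_def has_derivative_at_withinI)
      show "onorm (\<lambda>h. h *\<^sub>R \<psi> r x) \<le> w x" if "r \<in> {-1..1}" for r
        using bound[of r x] that by (intro onorm_le) (auto simp: mult.commute abs_le_iff intro!: mult_left_mono)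
    qed (use s in auto)
    then have "norm (\<phi> s x - \<phi> 0 x) / \<bar>s\<bar> \<le> w x"
      using s(2) by (subst pos_divide_le_eq) auto
    moreover have "norm (?q s x) = norm (\<phi> s x - \<phi> 0 x) / \<bar>s\<bar>"
      by (simp add: divide_inverse mult.commute)
    ultimately show ?thesis by (rule ord_eq_le_trans[rotated])
  qed
  have "((\<lambda>s. ((LINT x|M. \<phi> s x) - (LINT x|M. \<phi> 0 x)) /\<^sub>R s) \<longlongrightarrow> (LINT x|M. \<psi> 0 x)) (at 0 within {-1<..<1})"
    unfolding tendsto_at_iff_sequentially
  proof (intro allI impI)
    fix X :: "nat \<Rightarrow> real"
    assume X: "\<forall>i. X i \<in> {-1<..<1} - {0}" "X \<longlonglongrightarrow> 0"
    have "(\<lambda>i. LINT x|M. ?q (X i) x) \<longlonglongrightarrow> (LINT x|M. \<psi> 0 x)"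
    proof (rule integral_dominated_convergence[where w = w])
      show "AE x in M. (\<lambda>i. ?q (X i) x) \<longlonglongrightarrow> \<psi> 0 x"
      proof (rule AE_I2)
        show "(\<lambda>i. ?q (X i) x) \<longlonglongrightarrow> \<psi> 0 x" for x
          using lim[of x, unfolded tendsto_at_iff_sequentially, rule_format, of X] X by (simp add: o_def)
      qed
      show "AE x in M. norm (?q (X i) x) \<le> w x" for i
        using X(1) by (intro AE_I2 q_bound) (auto simp: abs_less_iff)
      show "?q (X i) \<in> borel_measurable M" for i
        by (intro borel_measurable_integrable integrable_scaleR_right Bochner_Integration.integrable_diff int)
    qed fact+
    then show "((\<lambda>s. ((LINT x|M. \<phi> s x) - (LINT x|M. \<phi> 0 x)) /\<^sub>R s) \<circ> X) \<longlonglongrightarrow> (LINT x|M. \<psi> 0 x)"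
      using int by (simp add: o_def)
  qed
  then have "((\<lambda>s. ((LINT x|M. \<phi> s x) - (LINT x|M. \<phi> 0 x)) /\<^sub>R s) \<longlongrightarrow> (LINT x|M. \<psi> 0 x)) (at 0)"
    by (simp add: at_within_open[of 0 "{-1<..<1}"])
  then show ?thesis by (simp add: has_vector_derivative_at_0_iff)
qed

lemma integral_lborel_translate:
  fixes h :: "'a::euclidean_space \<Rightarrow> 'c::{banach, second_countable_topology}"
  assumes "h \<in> borel_measurable borel"
  shows "(LINT x|lborel. h (x + c)) = (LINT x|lborel. h x)"
proof -
  have "(LINT x|lborel. h x) = (LINT x|distr lborel borel ((+) c). h x)"
    by (simp add: lborel_distr_plus)
  also have "\<dots> = (LINT x|lborel. h (c + x))" using assms by (subst integral_distr) auto
  finally show ?thesis by (simp add: add.commute)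
qed

text \<open>The sign \<open>\<sigma> = -1\<close> is the Fourier transform, \<open>\<sigma> = 1\<close> its inverse up to a power of \<open>2\<pi>\<close>.\<close>
definition fourier :: "real \<Rightarrow> ('a \<times> 'b::euclidean_space \<Rightarrow> complex) \<Rightarrow> 'a \<times> 'b \<Rightarrow> complex" where
  "fourier \<sigma> f p = (LINT x|lborel. f (fst p, x) * cis (\<sigma> * (x \<bullet> snd p)))"

lemma partial_fourier_eq: "partial_fourier f = fourier (-1) f"
  by (auto simp: fun_eq_iff partial_fourier_def fourier_def cis_conv_exp)

lemma continuous_slice:
  assumes "continuous_on UNIV (f :: 'a::topological_space \<times> 'b::topological_space \<Rightarrow> complex)"
  shows "continuous_on UNIV (\<lambda>x. f (t, x))"
  by (rule continuous_on_compose2[OF assms]) (auto intro!: continuous_intros)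

lemma rapid_slice_measurable:
  assumes "rapid f"
  shows "(\<lambda>x. f (t, x)) \<in> borel_measurable borel"
  using continuous_slice[OF rapidD(1)[OF assms]] by (rule borel_measurable_continuous_onI)

lemma cis_inner_measurable: "(\<lambda>x. cis (\<sigma> * (x \<bullet> \<xi>))) \<in> borel_measurable borel"
  for \<xi> :: "'b::euclidean_space"
  by (rule borel_measurable_continuous_onI) (auto intro!: continuous_intros)

lemma rapid_slice_integrable:
  assumes "rapid f"
  shows "integrable lborel (\<lambda>x. f (t, x) * cis (\<sigma> * (x \<bullet> \<xi>)))"
proof -
  obtain C where C: "C \<ge> 0" "\<And>t x. norm (f (t, x)) \<le> C * weight x"
    using decays_le_weight[OF rapidD(2)[OF assms]] by blast
  show ?thesis
  proof (rule Bochner_Integration.integrable_bound)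
    show "integrable lborel (\<lambda>x. C * weight x)" by (simp add: integrable_weight)
    show "(\<lambda>x. f (t, x) * cis (\<sigma> * (x \<bullet> \<xi>))) \<in> borel_measurable lborel"
      using borel_measurable_times[OF rapid_slice_measurable[OF assms] cis_inner_measurable] by simp
    show "AE x in lborel. norm (f (t, x) * cis (\<sigma> * (x \<bullet> \<xi>))) \<le> norm (C * weight x)"
      using C by (auto simp: norm_mult weight_nonneg)
  qed
qed

lemma fourier_lincomb:
  assumes "rapid f" "rapid g"
  shows "fourier \<sigma> (\<lambda>p. c * f p + d * g p) q = c * fourier \<sigma> f q + d * fourier \<sigma> g q"
proof -
  note int = rapid_slice_integrable[OF assms(1), of "fst q" \<sigma> "snd q"]
    rapid_slice_integrable[OF assms(2), of "fst q" \<sigma> "snd q"]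
  show ?thesis
    unfolding fourier_def distrib_right mult.assoc using int by simp
qed

lemma fourier_sum:
  assumes "\<And>i. i \<in> I \<Longrightarrow> rapid (f i)"
  shows "fourier \<sigma> (\<lambda>p. \<Sum>i\<in>I. f i p) q = (\<Sum>i\<in>I. fourier \<sigma> (f i) q)"
  unfolding fourier_def sum_distrib_right
  by (rule Bochner_Integration.integral_sum) (rule rapid_slice_integrable[OF assms])

lemma fourier_bounded:
  fixes f :: "'a::euclidean_space \<times> 'b::euclidean_space \<Rightarrow> complex"
  assumes "rapid f"
  shows "\<exists>C. \<forall>p. norm (fourier \<sigma> f p) \<le> C"
proof -
  obtain C where C: "C \<ge> 0" "\<And>t x. norm (f (t, x)) \<le> C * weight x"
    using decays_le_weight[OF rapidD(2)[OF assms]] by blast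
  have "norm (fourier \<sigma> f p) \<le> (LINT x|lborel. C * weight (x::'b))" for p
    unfolding fourier_def
  proof (rule Bochner_Integration.integral_norm_bound_integral[OF rapid_slice_integrable[OF assms]])
    show "integrable lborel (\<lambda>x::'b. C * weight x)" by (simp add: integrable_weight)
  qed (simp add: norm_mult C)
  then show ?thesis by blast
qed

lemma fourier_continuous:
  fixes f :: "'a::euclidean_space \<times> 'b::euclidean_space \<Rightarrow> complex"
  assumes "rapid f"
  shows "continuous_on UNIV (fourier \<sigma> f)"
  unfolding continuous_on_eq_continuous_at[OF open_UNIV]
proof (intro ballI continuous_at_sequentiallyI)
  fix p and u :: "nat \<Rightarrow> 'a \<times> 'b"
  assume u: "u \<longlonglongrightarrow> p"
  obtain C where C: "C \<ge> 0" "\<And>t x. norm (f (t, x)) \<le> C * weight x"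
    using decays_le_weight[OF rapidD(2)[OF assms]] by blast
  show "(\<lambda>n. fourier \<sigma> f (u n)) \<longlonglongrightarrow> fourier \<sigma> f p"
    unfolding fourier_def
  proof (rule integral_dominated_convergence[where w = "\<lambda>x. C * weight x"])
    show "(\<lambda>x. f (fst (u n), x) * cis (\<sigma> * (x \<bullet> snd (u n)))) \<in> borel_measurable lborel" for n
      using borel_measurable_times[OF rapid_slice_measurable[OF assms] cis_inner_measurable] by simp
    show "(\<lambda>x. f (fst p, x) * cis (\<sigma> * (x \<bullet> snd p))) \<in> borel_measurable lborel"
      using borel_measurable_times[OF rapid_slice_measurable[OF assms] cis_inner_measurable] by simp
    show "integrable lborel (\<lambda>x. C * weight x)" by (simp add: integrable_weight)
    show "AE x in lborel. norm (f (fst (u n), x) * cis (\<sigma> * (x \<bullet> snd (u n)))) \<le> C * weight x" for n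
      using C by (auto simp: norm_mult)
    have "(\<lambda>n. f (fst (u n), x) * cis (\<sigma> * (x \<bullet> snd (u n)))) \<longlonglongrightarrow> f (fst p, x) * cis (\<sigma> * (x \<bullet> snd p))" for x
    proof -
      have "continuous_on UNIV (\<lambda>q. f (fst q, x) * cis (\<sigma> * (x \<bullet> snd q)))"
        by (intro continuous_intros continuous_on_compose2[OF rapidD(1)[OF assms]]) auto
      then show ?thesis
        using continuous_on_tendsto_compose[OF _ u, of UNIV] by auto
    qed
    then show "AE x in lborel. (\<lambda>n. f (fst (u n), x) * cis (\<sigma> * (x \<bullet> snd (u n)))) \<longlonglongrightarrow> f (fst p, x) * cis (\<sigma> * (x \<bullet> snd p))"
      by simp
  qed
qed

lemma has_vector_derivative_cis_affine:
  "((\<lambda>s. cis (a + s * c)) has_vector_derivative \<i> * of_real c * cis (a + s * c)) (at s)"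
proof -
  have "((\<lambda>s. exp (\<i> * (of_real a + of_real s * of_real c))) has_vector_derivative
      \<i> * of_real c * exp (\<i> * (of_real a + of_real s * of_real c))) (at s)"
    by (rule has_vector_derivative_real_field derivative_eq_intros refl | simp)+
  then show ?thesis by (simp add: cis_conv_exp)
qed

lemma fourier_deriv_torus:
  assumes f: "rapid f" and b: "b = (a, 0)" "b \<in> Basis"
  shows "((\<lambda>s. fourier \<sigma> f (p + s *\<^sub>R b)) has_vector_derivative fourier \<sigma> (partial_deriv b f) p) (at 0)"
proof -
  obtain t \<xi> where p: "p = (t, \<xi>)" by (cases p)
  obtain C where C: "C \<ge> 0" "\<And>t x. norm (partial_deriv b f (t, x)) \<le> C * weight x"
    using decays_le_weight[OF rapidD(2)[OF rapidD(4)[OF f b(2)]]] by blast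
  have "((\<lambda>s. LINT x|lborel. f (t + s *\<^sub>R a, x) * cis (\<sigma> * (x \<bullet> \<xi>))) has_vector_derivative
      (LINT x|lborel. partial_deriv b f (t + 0 *\<^sub>R a, x) * cis (\<sigma> * (x \<bullet> \<xi>)))) (at 0)"
  proof (rule has_vector_derivative_integral)
    show "integrable lborel (\<lambda>x. C * weight x)" by (simp add: integrable_weight)
    show "integrable lborel (\<lambda>x. f (t + s *\<^sub>R a, x) * cis (\<sigma> * (x \<bullet> \<xi>)))" for s
      by (rule rapid_slice_integrable[OF f])
    show "norm (partial_deriv b f (t + s *\<^sub>R a, x) * cis (\<sigma> * (x \<bullet> \<xi>))) \<le> C * weight x" for s x
      using C by (simp add: norm_mult)
    show "(\<lambda>x. partial_deriv b f (t + 0 *\<^sub>R a, x) * cis (\<sigma> * (x \<bullet> \<xi>))) \<in> borel_measurable lborel"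
      using borel_measurable_times[OF rapid_slice_measurable[OF rapidD(4)[OF f b(2)]] cis_inner_measurable] by simp
    show "((\<lambda>s. f (t + s *\<^sub>R a, x) * cis (\<sigma> * (x \<bullet> \<xi>))) has_vector_derivative
        partial_deriv b f (t + s *\<^sub>R a, x) * cis (\<sigma> * (x \<bullet> \<xi>))) (at s)" for s x
      using rapid_has_partial_deriv[OF f b(2), of "(t, x)" s]
      by (intro has_vector_derivative_mult_left) (simp add: b(1))
  qed
  then show ?thesis by (simp add: fourier_def p b(1))
qed

lemma fourier_deriv_frequency:
  fixes f :: "'a::euclidean_space \<times> 'b::euclidean_space \<Rightarrow> complex"
  assumes f: "rapid f" and j: "j \<in> Basis"
  shows "((\<lambda>s. fourier \<sigma> f (p + s *\<^sub>R (0, j))) has_vector_derivative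
    fourier \<sigma> (\<lambda>p. \<i> * of_real \<sigma> * (of_real (snd p \<bullet> j) * f p)) p) (at 0)"
proof -
  obtain t \<xi> where p: "p = (t, \<xi>)" by (cases p)
  let ?g = "\<lambda>p. \<i> * of_real \<sigma> * (of_real (snd p \<bullet> j) * f p)"
  have g: "rapid ?g" by (intro rapid_cmult rapid_mult_coord f j)
  obtain C where C: "C \<ge> 0" "\<And>t x. norm (?g (t, x)) \<le> C * weight x"
    using decays_le_weight[OF rapidD(2)[OF g]] by blast
  have "((\<lambda>s. LINT x|lborel. f (t, x) * cis (\<sigma> * (x \<bullet> (\<xi> + s *\<^sub>R j)))) has_vector_derivative
      (LINT x|lborel. ?g (t, x) * cis (\<sigma> * (x \<bullet> (\<xi> + 0 *\<^sub>R j))))) (at 0)"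
  proof (rule has_vector_derivative_integral)
    show "integrable lborel (\<lambda>x. C * weight x)" by (simp add: integrable_weight)
    show "integrable lborel (\<lambda>x. f (t, x) * cis (\<sigma> * (x \<bullet> (\<xi> + s *\<^sub>R j))))" for s
      by (rule rapid_slice_integrable[OF f])
    show "norm (?g (t, x) * cis (\<sigma> * (x \<bullet> (\<xi> + s *\<^sub>R j)))) \<le> C * weight x" for s x
      using C(2)[of t x] by (simp only: norm_mult norm_cis mult_1_right)
    show "(\<lambda>x. ?g (t, x) * cis (\<sigma> * (x \<bullet> (\<xi> + 0 *\<^sub>R j)))) \<in> borel_measurable lborel"
      using borel_measurable_times[OF rapid_slice_measurable[OF g] cis_inner_measurable] by simp
    show "((\<lambda>s. f (t, x) * cis (\<sigma> * (x \<bullet> (\<xi> + s *\<^sub>R j)))) has_vector_derivative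
        ?g (t, x) * cis (\<sigma> * (x \<bullet> (\<xi> + s *\<^sub>R j)))) (at s)" for s x
      using has_vector_derivative_mult_right[OF has_vector_derivative_cis_affine[of "\<sigma> * (x \<bullet> \<xi>)" "\<sigma> * (x \<bullet> j)" s], of "f (t, x)"]
      by (simp add: inner_add_right distrib_left mult_ac)
  qed
  then show ?thesis by (simp add: fourier_def p)
qed

text \<open>Integration by parts, obtained from translation invariance: translating \<open>f\<close> by \<open>s j\<close> multiplies
  the transform by \<open>exp (- i \<sigma> s (\<xi> \<bullet> j))\<close>. Both sides are differentiated at \<open>s = 0\<close>, the left one under
  the integral sign.\<close>
lemma fourier_partial_deriv:
  fixes f :: "'a::euclidean_space \<times> 'b::euclidean_space \<Rightarrow> complex"
  assumes f: "rapid f" and j: "j \<in> Basis"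
  shows "fourier \<sigma> (partial_deriv (0, j) f) p = - \<i> * of_real (\<sigma> * (snd p \<bullet> j)) * fourier \<sigma> f p"
proof -
  obtain t \<xi> where p: "p = (t, \<xi>)" by (cases p)
  let ?b = "(0, j) :: 'a \<times> 'b"
  have b: "?b \<in> Basis" using j by (auto simp: Basis_prod_def)
  obtain C where C: "C \<ge> 0" "\<And>t x. norm (partial_deriv ?b f (t, x)) \<le> C * weight x"
    using decays_le_weight[OF rapidD(2)[OF rapidD(4)[OF f b]]] by blast
  have eq: "f (t, x + s *\<^sub>R j) * cis (\<sigma> * (x \<bullet> \<xi>))
      = (f (t, x + s *\<^sub>R j) * cis (\<sigma> * ((x + s *\<^sub>R j) \<bullet> \<xi>))) * cis (0 + s * (- \<sigma> * (\<xi> \<bullet> j)))" for s x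
    by (simp add: mult.assoc cis_mult inner_add_left inner_commute algebra_simps)
  have meas: "(\<lambda>x. f (t, x) * cis (\<sigma> * (x \<bullet> \<xi>))) \<in> borel_measurable borel"
    by (intro borel_measurable_times rapid_slice_measurable f cis_inner_measurable)
  have shift: "(LINT x|lborel. f (t, x + s *\<^sub>R j) * cis (\<sigma> * (x \<bullet> \<xi>)))
      = fourier \<sigma> f p * cis (0 + s * (- \<sigma> * (\<xi> \<bullet> j)))" for s
    unfolding eq integral_mult_left_zero integral_lborel_translate[OF meas]
    by (simp add: fourier_def p)
  have "((\<lambda>s. LINT x|lborel. f (t, x + s *\<^sub>R j) * cis (\<sigma> * (x \<bullet> \<xi>))) has_vector_derivative
      (LINT x|lborel. partial_deriv ?b f (t, x + 0 *\<^sub>R j) * cis (\<sigma> * (x \<bullet> \<xi>)))) (at 0)"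
  proof (rule has_vector_derivative_integral)
    show "integrable lborel (\<lambda>x. C * (3 ^ DIM('b) * weight (x::'b)))" by (simp add: integrable_weight)
    show "integrable lborel (\<lambda>x. f (t, x + s *\<^sub>R j) * cis (\<sigma> * (x \<bullet> \<xi>)))" for s
    proof -
      have "integrable (distr lborel borel ((+) (s *\<^sub>R j))) (\<lambda>x. f (t, x) * cis (\<sigma> * (x \<bullet> \<xi>)))"
        using rapid_slice_integrable[OF f] by (simp add: lborel_distr_plus)
      then have "integrable lborel (\<lambda>x. f (t, s *\<^sub>R j + x) * cis (\<sigma> * ((s *\<^sub>R j + x) \<bullet> \<xi>)))"
        by (subst (asm) integrable_distr_eq) (use meas in auto)
      then show ?thesis unfolding eq by (simp add: add.commute)
    qed
    show "norm (partial_deriv ?b f (t, x + s *\<^sub>R j) * cis (\<sigma> * (x \<bullet> \<xi>))) \<le> C * (3 ^ DIM('b) * weight x)"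
      if "\<bar>s\<bar> \<le> 1" for s x
    proof -
      have "norm (partial_deriv ?b f (t, x + s *\<^sub>R j) * cis (\<sigma> * (x \<bullet> \<xi>))) \<le> C * weight (x + s *\<^sub>R j)"
        using C(2) by (simp add: norm_mult)
      also have "\<dots> \<le> C * (3 ^ DIM('b) * weight x)"
        using C(1) that j by (intro mult_left_mono weight_translate_le) auto
      finally show ?thesis .
    qed
    show "(\<lambda>x. partial_deriv ?b f (t, x + 0 *\<^sub>R j) * cis (\<sigma> * (x \<bullet> \<xi>))) \<in> borel_measurable lborel"
      using borel_measurable_times[OF rapid_slice_measurable[OF rapidD(4)[OF f b]] cis_inner_measurable] by simp
    show "((\<lambda>s. f (t, x + s *\<^sub>R j) * cis (\<sigma> * (x \<bullet> \<xi>))) has_vector_derivative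
        partial_deriv ?b f (t, x + s *\<^sub>R j) * cis (\<sigma> * (x \<bullet> \<xi>))) (at s)" for s x
      using rapid_has_partial_deriv[OF f b, of "(t, x)" s]
      by (intro has_vector_derivative_mult_left) simp
  qed
  then have "((\<lambda>s. fourier \<sigma> f p * cis (0 + s * (- \<sigma> * (\<xi> \<bullet> j)))) has_vector_derivative
      fourier \<sigma> (partial_deriv ?b f) p) (at 0)"
    unfolding shift by (simp add: fourier_def p)
  moreover have "((\<lambda>s. fourier \<sigma> f p * cis (0 + s * (- \<sigma> * (\<xi> \<bullet> j)))) has_vector_derivative
      fourier \<sigma> f p * (\<i> * of_real (- \<sigma> * (\<xi> \<bullet> j)) * cis (0 + 0 * (- \<sigma> * (\<xi> \<bullet> j))))) (at 0)"
    by (intro has_vector_derivative_mult_right has_vector_derivative_cis_affine)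
  ultimately have "fourier \<sigma> (partial_deriv ?b f) p
      = fourier \<sigma> f p * (\<i> * of_real (- \<sigma> * (\<xi> \<bullet> j)) * cis (0 + 0 * (- \<sigma> * (\<xi> \<bullet> j))))"
    by (rule vector_derivative_unique_at)
  then show ?thesis by (simp add: p)
qed

text \<open>The operator whose symbol is \<open>1 + \<bar>\<xi>\<bar>\<^sup>2\<close>; only the Euclidean variable is differentiated.\<close>
definition one_minus_laplacian :: "('a::euclidean_space \<times> 'b::euclidean_space \<Rightarrow> complex) \<Rightarrow> 'a \<times> 'b \<Rightarrow> complex" where
  "one_minus_laplacian f p = f p - (\<Sum>j\<in>Basis. partial_deriv (0, j) (partial_deriv (0, j) f) p)"

lemma zero_pair_in_Basis: "j \<in> Basis \<Longrightarrow> (0, j) \<in> Basis"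
  by (auto simp: Basis_prod_def)

lemma one_minus_laplacian_eq:
  "one_minus_laplacian f = (\<lambda>p. 1 * f p + (- 1) * (\<Sum>j\<in>Basis. partial_deriv (0, j) (partial_deriv (0, j) f) p))"
  by (simp add: one_minus_laplacian_def fun_eq_iff)

lemma rapid_laplacian:
  "rapid f \<Longrightarrow> rapid (\<lambda>p. \<Sum>j\<in>Basis. partial_deriv (0, j) (partial_deriv (0, j) f) p)"
  by (intro rapid_sum rapidD(4) zero_pair_in_Basis) auto

lemma rapid_one_minus_laplacian: "rapid f \<Longrightarrow> rapid (one_minus_laplacian f)"
  unfolding one_minus_laplacian_eq by (intro rapid_lincomb rapid_laplacian)

lemma fourier_one_minus_laplacian:
  assumes f: "rapid f" and \<sigma>: "\<sigma>\<^sup>2 = 1"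
  shows "fourier \<sigma> (one_minus_laplacian f) p = of_real (1 + (norm (snd p))\<^sup>2) * fourier \<sigma> f p"
proof -
  have "fourier \<sigma> (partial_deriv (0, j) (partial_deriv (0, j) f)) p = - of_real ((snd p \<bullet> j)\<^sup>2) * fourier \<sigma> f p"
    if j: "j \<in> Basis" for j
  proof -
    have "(of_real \<sigma> :: complex)\<^sup>2 = 1" using \<sigma> by (metis of_real_1 of_real_power)
    then show ?thesis
      using j f by (simp add: fourier_partial_deriv rapidD(4) zero_pair_in_Basis power2_eq_square algebra_simps)
  qed
  moreover have "(\<Sum>j\<in>Basis. (of_real (snd p \<bullet> j) :: complex)\<^sup>2) = (of_real (norm (snd p)))\<^sup>2"
    unfolding of_real_power[symmetric] of_real_sum[symmetric]
    unfolding power2_norm_eq_inner by (subst euclidean_inner) (simp add: power2_eq_square)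
  ultimately show ?thesis
    unfolding one_minus_laplacian_eq fourier_lincomb[OF f rapid_laplacian[OF f]]
    using f by (simp add: fourier_sum rapidD(4) zero_pair_in_Basis sum_negf sum_distrib_right[symmetric]
        distrib_right)
qed

text \<open>Each factor \<open>1 + \<bar>\<xi>\<bar>\<^sup>2\<close> is absorbed into the function by applying \<open>1 - \<Delta>\<close> to it, and the
  transform of a rapid function is bounded.\<close>
lemma fourier_decays:
  assumes "rapid f" and \<sigma>: "\<sigma>\<^sup>2 = 1"
  shows "decays (fourier \<sigma> f)"
  unfolding decays_def
proof
  fix N
  show "\<exists>C. \<forall>p. norm (fourier \<sigma> f p) * (1 + (norm (snd p))\<^sup>2) ^ N \<le> C"
    using assms(1)
  proof (induction N arbitrary: f)
    case 0
    then show ?case using fourier_bounded[of f \<sigma>] by simp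
  next
    case (Suc N)
    from Suc.IH[OF rapid_one_minus_laplacian[OF Suc.prems]] show ?case
      by (simp add: fourier_one_minus_laplacian[OF Suc.prems \<sigma>] norm_mult mult_ac del: of_real_add of_real_power)
  qed
qed

text \<open>Coinduction with the family of all transforms of rapid functions. Differentiating in a torus
  direction differentiates \<open>f\<close>, and in a frequency direction it multiplies \<open>f\<close> by a coordinate.\<close>
theorem rapid_fourier:
  fixes f :: "'a::euclidean_space \<times> 'b::euclidean_space \<Rightarrow> complex"
  assumes "rapid f" and \<sigma>: "\<sigma>\<^sup>2 = 1"
  shows "rapid (fourier \<sigma> f)"
proof (rule rapid_coinduct_upto[where X = "\<lambda>h. \<exists>f. rapid f \<and> h = fourier \<sigma> f"])
  fix h :: "'a \<times> 'b \<Rightarrow> complex" and b :: "'a \<times> 'b"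
  assume "\<exists>f. rapid f \<and> h = fourier \<sigma> f" and b: "b \<in> Basis"
  then obtain f where f: "rapid f" "h = fourier \<sigma> f" by blast
  \<comment> \<open>The axes of the product space are those of the torus directions and of the frequencies.\<close>
  consider a where "b = (a, 0)" | j where "b = (0, j)" "j \<in> Basis"
    using b by (auto simp: Basis_prod_def)
  then show "\<exists>h'. (\<exists>f. rapid f \<and> h' = fourier \<sigma> f) \<and>
      (\<forall>p. ((\<lambda>s. h (p + s *\<^sub>R b)) has_vector_derivative h' p) (at 0))"
  proof cases
    case 1
    then show ?thesis using fourier_deriv_torus[OF f(1) _ b] rapidD(4)[OF f(1) b] f(2) by blast
  next
    case 2
    then show ?thesis
      using fourier_deriv_frequency[OF f(1), of j \<sigma>] rapid_cmult[OF rapid_mult_coord[OF f(1)]] f(2) by blast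
  qed
qed (use assms fourier_continuous fourier_decays in blast)+

section \<open>Fourier inversion\<close>

definition gauss :: "'a::real_normed_vector \<Rightarrow> real" where
  "gauss x = exp (- (norm x)\<^sup>2 / 2)"

lemma gauss_bounds: "0 < gauss x" "gauss x \<le> 1"
  by (auto simp: gauss_def)

lemma abs_gauss [simp]: "\<bar>gauss x\<bar> = gauss x"
  using gauss_bounds(1)[of x] by simp

lemma gauss_measurable: "gauss \<in> borel_measurable borel"
  unfolding gauss_def by (rule borel_measurable_continuous_onI) (auto intro!: continuous_intros)

lemma prod_std_normal_density:
  fixes x :: "'a::euclidean_space"
  shows "(\<Prod>b\<in>Basis. std_normal_density (x \<bullet> b)) = gauss x / sqrt (2 * pi) ^ DIM('a)"
proof -
  have "(norm x)\<^sup>2 = (\<Sum>b\<in>Basis. (x \<bullet> b)\<^sup>2)"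
    unfolding power2_norm_eq_inner by (subst euclidean_inner) (simp add: power2_eq_square)
  then have "gauss x = (\<Prod>b\<in>Basis. exp (- (x \<bullet> b)\<^sup>2 / 2))"
    by (simp add: gauss_def exp_sum[symmetric] sum_negf sum_divide_distrib)
  then show ?thesis
    by (simp add: std_normal_density_def prod.distrib prod_dividef power_divide)
qed

lemma
  shows integrable_std_normal_density_cis:
      "integrable lborel (\<lambda>x. of_real (std_normal_density x) * cis (x * t))" (is ?I)
    and integral_std_normal_density_cis:
      "(LINT x|lborel. of_real (std_normal_density x) * cis (x * t)) = of_real (exp (- t\<^sup>2 / 2))" (is ?E)
proof -
  have cis: "(\<lambda>x. cis (x * t)) \<in> borel_measurable borel"
    by (rule borel_measurable_continuous_onI) (auto intro!: continuous_intros)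
  have int: "integrable lborel std_normal_density"
    using integrable_std_normal_moment[of 0] by simp
  show ?I
  proof (rule Bochner_Integration.integrable_bound[OF int])
    show "(\<lambda>x. of_real (std_normal_density x) * cis (x * t)) \<in> borel_measurable lborel"
      using cis by simp
  qed (simp add: norm_mult)
  have "(LINT x|lborel. of_real (std_normal_density x) * cis (x * t))
      = (LINT x|density lborel std_normal_density. cis (x * t))"
    by (subst integral_density) (use cis in \<open>auto simp: scaleR_conv_of_real\<close>)
  also have "\<dots> = char std_normal_distribution t"
    by (simp add: char_def cis_conv_exp mult_ac)
  finally show ?E by (simp add: char_std_normal_distribution)
qed

lemma prod_cis_inner: "(\<Prod>b\<in>Basis. cis ((x \<bullet> b) * (u \<bullet> b))) = cis (x \<bullet> u)"
  for x :: "'a::euclidean_space"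
  by (subst euclidean_inner) (simp add: cis_conv_exp exp_sum[symmetric] sum_distrib_left)

lemma
  fixes u :: "'a::euclidean_space"
  shows integrable_gauss_cis: "integrable lborel (\<lambda>x. of_real (gauss x) * cis (x \<bullet> u))" (is ?I)
    and integral_gauss_cis:
      "(LINT x|lborel. of_real (gauss x) * cis (x \<bullet> u)) = of_real (sqrt (2 * pi) ^ DIM('a) * gauss u)" (is ?E)
proof -
  let ?f = "\<lambda>b x. of_real (std_normal_density x) * cis (x * (u \<bullet> b))"
  have eq: "(\<Prod>b\<in>Basis. ?f b (x \<bullet> b)) = of_real (gauss x) * cis (x \<bullet> u) / of_real (sqrt (2 * pi) ^ DIM('a))" for x
    by (simp only: prod.distrib prod_cis_inner of_real_prod[symmetric] prod_std_normal_density) simp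
  have nz: "(of_real (sqrt (2 * pi) ^ DIM('a)) :: complex) \<noteq> 0" by simp
  have "integrable lborel (\<lambda>x. \<Prod>b\<in>Basis. ?f b (x \<bullet> b))"
    by (intro integrable_lborel_prod integrable_std_normal_density_cis)
  then have "integrable lborel (\<lambda>x. (\<Prod>b\<in>Basis. ?f b (x \<bullet> b)) * of_real (sqrt (2 * pi) ^ DIM('a)))"
    by (rule integrable_mult_left)
  then show ?I unfolding eq using nz by simp
  have "(LINT x|lborel. (\<Prod>b\<in>Basis. ?f b (x \<bullet> b))) = (\<Prod>b\<in>Basis. LINT x|lborel. ?f b x)"
    by (intro integral_lborel_prod integrable_std_normal_density_cis)
  also have "\<dots> = of_real (\<Prod>b\<in>Basis. exp (- (u \<bullet> b)\<^sup>2 / 2))"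
    by (simp only: integral_std_normal_density_cis of_real_prod)
  also have "(\<Prod>b\<in>Basis. exp (- (u \<bullet> b)\<^sup>2 / 2)) = gauss u"
  proof -
    have "(norm u)\<^sup>2 = (\<Sum>b\<in>Basis. (u \<bullet> b)\<^sup>2)"
      unfolding power2_norm_eq_inner by (subst euclidean_inner) (simp add: power2_eq_square)
    then show ?thesis by (simp add: gauss_def exp_sum[symmetric] sum_negf sum_divide_distrib)
  qed
  finally show ?E unfolding eq using nz by (simp add: field_simps)
qed

lemma
  shows integrable_gauss: "integrable lborel (gauss :: 'a::euclidean_space \<Rightarrow> real)"
    and integral_gauss: "(LINT x|lborel. gauss (x::'a)) = sqrt (2 * pi) ^ DIM('a)"
proof -
  show "integrable lborel (gauss :: 'a \<Rightarrow> real)"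
    using integrable_norm[OF integrable_gauss_cis[of "0::'a"]] by simp
  have "complex_of_real (LINT x|lborel. gauss (x::'a)) = of_real (sqrt (2 * pi) ^ DIM('a))"
    using integral_gauss_cis[of "0::'a"] by (simp add: gauss_def)
  then show "(LINT x|lborel. gauss (x::'a)) = sqrt (2 * pi) ^ DIM('a)"
    by (simp only: of_real_eq_iff)
qed

lemma integral_lborel_affine:
  fixes h :: "'a::euclidean_space \<Rightarrow> 'c::{banach, second_countable_topology}"
  assumes h: "h \<in> borel_measurable borel" and c: "c > 0"
  shows "(LINT y|lborel. h y) = c ^ DIM('a) *\<^sub>R (LINT v|lborel. h (x + c *\<^sub>R v))"
proof -
  have T: "(\<lambda>v. x + c *\<^sub>R v) \<in> lborel \<rightarrow>\<^sub>M borel" by simp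
  have "(LINT y|lborel. h y) = (LINT y|density (distr lborel borel (\<lambda>v. x + c *\<^sub>R v)) (\<lambda>_. ennreal (c ^ DIM('a))). h y)"
    using c lborel_affine[of c x] by simp
  also have "\<dots> = (LINT y|distr lborel borel (\<lambda>v. x + c *\<^sub>R v). c ^ DIM('a) *\<^sub>R h y)"
    using h c by (subst integral_density) auto
  also have "\<dots> = (LINT v|lborel. c ^ DIM('a) *\<^sub>R h (x + c *\<^sub>R v))"
    using h by (subst integral_distr[OF T]) auto
  finally show ?thesis by simp
qed

lemma integral_gauss_scaled_cis:
  fixes u :: "'a::euclidean_space"
  assumes k: "k > 0"
  shows "(LINT \<xi>|lborel. of_real (gauss (\<xi> /\<^sub>R k)) * cis (\<xi> \<bullet> u))
    = of_real (sqrt (2 * pi) ^ DIM('a) * (k ^ DIM('a) * gauss (k *\<^sub>R u)))"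
proof -
  have "(\<lambda>\<xi>. of_real (gauss (\<xi> /\<^sub>R k)) * cis (\<xi> \<bullet> u)) \<in> borel_measurable borel"
    unfolding gauss_def by (rule borel_measurable_continuous_onI) (auto intro!: continuous_intros)
  from integral_lborel_affine[OF this k, of 0]
  have "(LINT \<xi>|lborel. of_real (gauss (\<xi> /\<^sub>R k)) * cis (\<xi> \<bullet> u))
      = k ^ DIM('a) *\<^sub>R (LINT v|lborel. of_real (gauss v) * cis (v \<bullet> (k *\<^sub>R u)))"
    using k by simp
  then show ?thesis by (simp add: integral_gauss_cis scaleR_conv_of_real del: inner_scaleR_right)
qed

text \<open>A non-integrable function has Bochner integral \<open>0\<close>, whereas the integral computed above does
  not vanish.\<close>
lemma integrable_gauss_scaled:
  assumes "k > 0"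
  shows "integrable lborel (\<lambda>\<xi>::'a::euclidean_space. gauss (\<xi> /\<^sub>R k))"
proof (rule ccontr)
  assume "\<not> ?thesis"
  then have "(LINT \<xi>|lborel. gauss (\<xi> /\<^sub>R k :: 'a)) = 0" by (rule not_integrable_integral_eq)
  moreover have "complex_of_real (LINT \<xi>|lborel. gauss (\<xi> /\<^sub>R k :: 'a)) \<noteq> 0"
    using integral_gauss_scaled_cis[OF assms, of "0::'a"] assms by (simp add: gauss_def)
  ultimately show False by simp
qed

text \<open>The substitution \<open>y = x + v / k\<close>, where \<open>k\<close> is the scale \<open>i + 1\<close>, turns the integral into that of
  \<open>\<phi> (x + v / k) gauss v\<close>, and the bound on \<open>\<phi>\<close> allows dominated convergence.\<close>
lemma approximate_identity_local:
  fixes \<phi> :: "'a::euclidean_space \<Rightarrow> complex"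
  assumes \<phi>: "\<phi> \<in> borel_measurable borel" and bounded: "\<And>y. norm (\<phi> y) \<le> B" and cont: "isCont \<phi> x"
  shows "(\<lambda>i. LINT y|lborel. \<phi> y * of_real (real (Suc i) ^ DIM('a) * gauss (real (Suc i) *\<^sub>R (x - y))))
    \<longlonglongrightarrow> of_real (sqrt (2 * pi) ^ DIM('a)) * \<phi> x"
proof -
  have eq: "(LINT y|lborel. \<phi> y * of_real (real (Suc i) ^ DIM('a) * gauss (real (Suc i) *\<^sub>R (x - y))))
      = (LINT v|lborel. \<phi> (x + inverse (real (Suc i)) *\<^sub>R v) * of_real (gauss v))" for i
  proof -
    let ?k = "real (Suc i)"
    have k: "?k > 0" "inverse ?k > 0" by simp_all
    have "(\<lambda>y. complex_of_real (?k ^ DIM('a) * gauss (?k *\<^sub>R (x - y)))) \<in> borel_measurable borel"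
      unfolding gauss_def by (rule borel_measurable_continuous_onI) (auto intro!: continuous_intros)
    with \<phi> have "(\<lambda>y. \<phi> y * of_real (?k ^ DIM('a) * gauss (?k *\<^sub>R (x - y)))) \<in> borel_measurable borel"
      by (rule borel_measurable_times)
    from integral_lborel_affine[OF this k(2), of x]
    have "(LINT y|lborel. \<phi> y * of_real (?k ^ DIM('a) * gauss (?k *\<^sub>R (x - y))))
      = inverse ?k ^ DIM('a) *\<^sub>R (LINT v|lborel. \<phi> (x + inverse ?k *\<^sub>R v) * of_real (?k ^ DIM('a) * gauss (?k *\<^sub>R (- (inverse ?k *\<^sub>R v)))))"
      by simp
    also have "\<dots> = inverse ?k ^ DIM('a) *\<^sub>R (?k ^ DIM('a) *\<^sub>R (LINT v|lborel. \<phi> (x + inverse ?k *\<^sub>R v) * of_real (gauss v)))"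
      unfolding integral_scaleR_right[symmetric] using k(1)
      by (intro arg_cong2[where f = scaleR] Bochner_Integration.integral_cong refl)
        (simp add: gauss_def scaleR_conv_of_real mult_ac)
    also have "\<dots> = (LINT v|lborel. \<phi> (x + inverse ?k *\<^sub>R v) * of_real (gauss v))"
      using k(1) by (simp add: power_mult_distrib[symmetric] del: of_nat_Suc)
    finally show ?thesis .
  qed
  have lim: "(\<lambda>i. LINT v|lborel. \<phi> (x + inverse (real (Suc i)) *\<^sub>R v) * of_real (gauss v))
      \<longlonglongrightarrow> (LINT v|lborel. \<phi> x * of_real (gauss (v::'a)))"
  proof (rule integral_dominated_convergence[where w = "\<lambda>v::'a. B * gauss v"])
    show "integrable lborel (\<lambda>v::'a. B * gauss v)" by (simp add: integrable_gauss)
    show "AE v in lborel. norm (\<phi> (x + inverse (real (Suc i)) *\<^sub>R v) * of_real (gauss v)) \<le> B * gauss v" for i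
      by (intro AE_I2) (simp add: norm_mult mult_right_mono[OF bounded less_imp_le[OF gauss_bounds(1)]])
    show "(\<lambda>v. \<phi> (x + inverse (real (Suc i)) *\<^sub>R v) * of_real (gauss v)) \<in> borel_measurable lborel" for i
    proof -
      have "(\<lambda>v. \<phi> (x + inverse (real (Suc i)) *\<^sub>R v)) \<in> borel_measurable borel"
        by (rule measurable_compose[OF _ \<phi>]) simp
      then show ?thesis using gauss_measurable[where 'a = 'a] by simp
    qed
    show "(\<lambda>v::'a. \<phi> x * of_real (gauss v)) \<in> borel_measurable lborel"
      using gauss_measurable[where 'a = 'a] by simp
    have "(\<lambda>i. \<phi> (x + inverse (real (Suc i)) *\<^sub>R v) * of_real (gauss v)) \<longlonglongrightarrow> \<phi> x * of_real (gauss v)" for v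
    proof -
      have "(\<lambda>i. x + inverse (real (Suc i)) *\<^sub>R v) \<longlonglongrightarrow> x + 0 *\<^sub>R v"
        by (intro tendsto_intros LIMSEQ_inverse_real_of_nat)
      then have "(\<lambda>i. \<phi> (x + inverse (real (Suc i)) *\<^sub>R v)) \<longlonglongrightarrow> \<phi> x"
        using cont by (intro isCont_tendsto_compose[of x \<phi>]) simp_all
      then show ?thesis by (rule tendsto_mult_right)
    qed
    then show "AE v in lborel. (\<lambda>i. \<phi> (x + inverse (real (Suc i)) *\<^sub>R v) * of_real (gauss v)) \<longlonglongrightarrow> \<phi> x * of_real (gauss v)"
      by simp
  qed
  have "(LINT v|lborel. \<phi> x * of_real (gauss (v::'a))) = of_real (sqrt (2 * pi) ^ DIM('a)) * \<phi> x"
    using integral_gauss[where 'a = 'a] by (simp add: integral_complex_of_real)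
  with lim show ?thesis unfolding eq by (simp only:)
qed

text \<open>Where \<open>\<bar>x - y\<bar> \<ge> 1\<close>, the kernel with scale \<open>k\<close> is at most \<open>k\<^sup>n exp (- k / 2)\<close>, because \<open>k \<le> k\<^sup>2\<close>.
  This tends to \<open>0\<close> uniformly in \<open>y\<close>.\<close>
lemma approximate_identity_far:
  fixes \<phi> :: "'a::euclidean_space \<Rightarrow> complex"
  assumes \<phi>: "integrable lborel \<phi>" and far: "\<And>y. norm (x - y) < 1 \<Longrightarrow> \<phi> y = 0"
  shows "(\<lambda>i. LINT y|lborel. \<phi> y * of_real (real (Suc i) ^ DIM('a) * gauss (real (Suc i) *\<^sub>R (x - y)))) \<longlonglongrightarrow> 0"
proof (rule tendsto_norm_zero_cancel, rule tendsto_sandwich)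
  let ?n = "DIM('a)"
  show "\<forall>\<^sub>F i in sequentially. 0 \<le> norm (LINT y|lborel. \<phi> y * of_real (real (Suc i) ^ ?n * gauss (real (Suc i) *\<^sub>R (x - y))))"
    by simp
  have "norm (LINT y|lborel. \<phi> y * of_real (real (Suc i) ^ ?n * gauss (real (Suc i) *\<^sub>R (x - y))))
      \<le> real (Suc i) ^ ?n * exp (- (real (Suc i) / 2)) * (LINT y|lborel. norm (\<phi> y))" for i
  proof -
    let ?k = "real (Suc i)"
    have bound: "norm (\<phi> y * of_real (?k ^ ?n * gauss (?k *\<^sub>R (x - y)))) \<le> ?k ^ ?n * exp (- (?k / 2)) * norm (\<phi> y)" for y
    proof (cases "norm (x - y) < 1")
      case True
      then show ?thesis by (simp add: far)
    next
      case False
      have "?k * 1 \<le> ?k * ?k" by (intro mult_left_mono) auto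
      also have "?k * ?k \<le> (norm (?k *\<^sub>R (x - y)))\<^sup>2"
      proof -
        have "?k * 1 \<le> ?k * norm (x - y)" using False by (intro mult_left_mono) auto
        then have "?k \<le> norm (?k *\<^sub>R (x - y))" by simp
        then show ?thesis unfolding power2_eq_square by (intro mult_mono) auto
      qed
      finally have "gauss (?k *\<^sub>R (x - y)) \<le> exp (- (?k / 2))"
        unfolding gauss_def by simp
      then show ?thesis
        by (subst norm_mult, subst mult.commute, intro mult_right_mono)
          (auto simp: norm_mult norm_power simp del: of_nat_Suc intro!: mult_left_mono)
    qed
    have "norm (LINT y|lborel. \<phi> y * of_real (?k ^ ?n * gauss (?k *\<^sub>R (x - y))))
        \<le> (LINT y|lborel. norm (\<phi> y * of_real (?k ^ ?n * gauss (?k *\<^sub>R (x - y)))))"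
      by (rule integral_norm_bound)
    also have "\<dots> \<le> (LINT y|lborel. ?k ^ ?n * exp (- (?k / 2)) * norm (\<phi> y))"
    proof (rule integral_mono')
      show "integrable lborel (\<lambda>y. ?k ^ ?n * exp (- (?k / 2)) * norm (\<phi> y))"
        using \<phi> by simp
    qed (use bound in simp_all)
    finally show ?thesis by simp
  qed
  then show "\<forall>\<^sub>F i in sequentially. norm (LINT y|lborel. \<phi> y * of_real (real (Suc i) ^ ?n * gauss (real (Suc i) *\<^sub>R (x - y))))
      \<le> real (Suc i) ^ ?n * exp (- (real (Suc i) / 2)) * (LINT y|lborel. norm (\<phi> y))"
    by simp
  \<comment> \<open>The bound is \<open>2\<^sup>n z\<^sup>n / exp z\<close> at \<open>z = k / 2\<close>, up to the integral of \<open>\<bar>\<phi>\<bar>\<close>.\<close>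
  have "((\<lambda>z::real. 2 ^ ?n * (z ^ ?n / exp z)) \<longlongrightarrow> 2 ^ ?n * 0) at_top"
    by (intro tendsto_mult_left tendsto_power_div_exp_0)
  moreover have "filterlim (\<lambda>i. real (Suc i) / 2) at_top sequentially" by real_asymp
  ultimately have "(\<lambda>i. 2 ^ ?n * ((real (Suc i) / 2) ^ ?n / exp (real (Suc i) / 2))) \<longlonglongrightarrow> 2 ^ ?n * 0"
    by (rule filterlim_compose)
  moreover have "2 ^ ?n * ((z / 2) ^ ?n / exp (z / 2)) = z ^ ?n * exp (- (z / 2))" for z :: real
    unfolding power_divide exp_minus divide_inverse[of "z ^ ?n" "exp (z / 2)", symmetric]
    by simp
  ultimately have "(\<lambda>i. real (Suc i) ^ ?n * exp (- (real (Suc i) / 2))) \<longlonglongrightarrow> 0"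
    by (simp only: mult_zero_right)
  then show "(\<lambda>i. real (Suc i) ^ ?n * exp (- (real (Suc i) / 2)) * (LINT y|lborel. norm (\<phi> y))) \<longlonglongrightarrow> 0"
    by (rule tendsto_mult_left_zero)
qed simp

text \<open>An integrable function need not be bounded, so the two previous lemmas are applied to the parts
  of \<open>\<phi>\<close> inside and outside the unit ball around \<open>x\<close>. Inside, continuity gives a bound.\<close>
lemma approximate_identity:
  fixes \<phi> :: "'a::euclidean_space \<Rightarrow> complex"
  assumes \<phi>: "integrable lborel \<phi>" and cont: "continuous_on UNIV \<phi>"
  shows "(\<lambda>i. LINT y|lborel. \<phi> y * of_real (real (Suc i) ^ DIM('a) * gauss (real (Suc i) *\<^sub>R (x - y))))
    \<longlonglongrightarrow> of_real (sqrt (2 * pi) ^ DIM('a)) * \<phi> x"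
proof -
  let ?K = "\<lambda>i y. complex_of_real (real (Suc i) ^ DIM('a) * gauss (real (Suc i) *\<^sub>R (x - y)))"
  let ?near = "\<lambda>y. indicator (ball x 1) y * \<phi> y" and ?far = "\<lambda>y. indicator (- ball x 1) y * \<phi> y"
  have \<phi>m: "\<phi> \<in> borel_measurable borel" using cont by (rule borel_measurable_continuous_onI)
  have Km: "?K i \<in> borel_measurable borel" for i
    unfolding gauss_def by (rule borel_measurable_continuous_onI) (auto intro!: continuous_intros)
  have near: "integrable lborel ?near" and far: "integrable lborel ?far"
    using integrable_mult_indicator[OF _ \<phi>, of "ball x 1"] integrable_mult_indicator[OF _ \<phi>, of "- ball x 1"]
    by (simp_all add: scaleR_conv_of_real of_real_indicator)
  have "bounded (\<phi> ` cball x 1)"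
    by (intro compact_imp_bounded compact_continuous_image continuous_on_subset[OF cont]) auto
  then obtain B where B: "\<And>y. y \<in> cball x 1 \<Longrightarrow> norm (\<phi> y) \<le> B" unfolding bounded_iff by blast
  have "0 \<le> B" using order_trans[OF norm_ge_zero B[of x]] by simp
  have "(\<lambda>i. LINT y|lborel. ?near y * ?K i y) \<longlonglongrightarrow> of_real (sqrt (2 * pi) ^ DIM('a)) * ?near x"
  proof (rule approximate_identity_local)
    show "?near \<in> borel_measurable borel" using borel_measurable_integrable[OF near] by simp
    show "norm (?near y) \<le> B" for y
      using B[of y] \<open>0 \<le> B\<close> by (simp add: indicator_def)
    have "isCont \<phi> x" using cont by (simp add: continuous_on_eq_continuous_at)
    moreover have "\<forall>\<^sub>F y in nhds x. \<phi> y = ?near y"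
      by (rule eventually_nhds_in_open[THEN eventually_mono, of "ball x 1"]) auto
    ultimately show "isCont ?near x" by (simp add: isCont_cong)
  qed
  moreover have "(\<lambda>i. LINT y|lborel. ?far y * ?K i y) \<longlonglongrightarrow> 0"
    by (rule approximate_identity_far[OF far]) (simp add: dist_norm)
  ultimately have "(\<lambda>i. (LINT y|lborel. ?near y * ?K i y) + (LINT y|lborel. ?far y * ?K i y))
      \<longlonglongrightarrow> of_real (sqrt (2 * pi) ^ DIM('a)) * ?near x + 0"
    by (rule tendsto_add)
  moreover have "(LINT y|lborel. \<phi> y * ?K i y) = (LINT y|lborel. ?near y * ?K i y) + (LINT y|lborel. ?far y * ?K i y)" for i
  proof -
    have bounded: "norm (?K i y) \<le> real (Suc i) ^ DIM('a)" for y
      using gauss_bounds[of "real (Suc i) *\<^sub>R (x - y)"]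
      by (simp add: norm_mult norm_power mult_left_le less_imp_le del: of_nat_Suc)
    have mult: "integrable lborel (\<lambda>y. g y * ?K i y)" if "integrable lborel g" for g
    proof (rule Bochner_Integration.integrable_bound)
      show "integrable lborel (\<lambda>y. real (Suc i) ^ DIM('a) *\<^sub>R g y)" using that by simp
      show "(\<lambda>y. g y * ?K i y) \<in> borel_measurable lborel"
        using borel_measurable_integrable[OF that] Km by (intro borel_measurable_times) simp_all
      show "AE y in lborel. norm (g y * ?K i y) \<le> norm (real (Suc i) ^ DIM('a) *\<^sub>R g y)"
        using mult_left_mono[OF bounded norm_ge_zero] by (intro AE_I2) (simp add: norm_mult mult.commute)
    qed
    have "\<phi> y * ?K i y = ?near y * ?K i y + ?far y * ?K i y" for y
      by (simp add: indicator_def)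
    then show ?thesis
      using Bochner_Integration.integral_add[OF mult[OF near] mult[OF far]] by simp
  qed
  ultimately show ?thesis by simp
qed

text \<open>The inverse transform of \<open>G\<close> is the limit of the integrals damped by the Gaussian factor
  \<open>gauss (\<xi> / k)\<close>. By Fubini's theorem a damped integral is a multiple of the convolution of \<open>\<phi>\<close>
  with the scaled Gaussian that is the transform of the damping factor, and these convolutions tend to \<open>\<phi> x\<close>.
  One factor \<open>(2\<pi>)\<^sup>n\<^sup>/\<^sup>2\<close> comes from the transform of the Gaussian and one from its integral.\<close>
theorem fourier_inversion:
  fixes \<phi> G :: "'a::euclidean_space \<Rightarrow> complex"
  assumes \<phi>: "integrable lborel \<phi>" and cont: "continuous_on UNIV \<phi>" and G: "integrable lborel G"
    and eq: "AE \<xi> in lborel. (LINT y|lborel. \<phi> y * cis (- (y \<bullet> \<xi>))) = G \<xi>"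
  shows "(LINT \<xi>|lborel. G \<xi> * cis (\<xi> \<bullet> x)) = of_real ((2 * pi) ^ DIM('a)) * \<phi> x"
proof -
  let ?n = "DIM('a)"
  let ?I = "\<lambda>i. LINT \<xi>|lborel. G \<xi> * cis (\<xi> \<bullet> x) * of_real (gauss (\<xi> /\<^sub>R real (Suc i)))"
  have Gm: "G \<in> borel_measurable borel" using borel_measurable_integrable[OF G] by simp
  have cm: "(\<lambda>\<xi>. cis (\<xi> \<bullet> x) * of_real (gauss (\<xi> /\<^sub>R k))) \<in> borel_measurable borel" for k
    unfolding gauss_def by (rule borel_measurable_continuous_onI) (auto intro!: continuous_intros)
  have "?I \<longlonglongrightarrow> (LINT \<xi>|lborel. G \<xi> * cis (\<xi> \<bullet> x))"
  proof (rule integral_dominated_convergence[where w = "\<lambda>\<xi>. norm (G \<xi>)"])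
    show "integrable lborel (\<lambda>\<xi>. norm (G \<xi>))" using G by simp
    show "(\<lambda>\<xi>. G \<xi> * cis (\<xi> \<bullet> x)) \<in> borel_measurable lborel"
      using borel_measurable_times[OF Gm cis_inner_measurable[of 1 x]] by simp
    show "(\<lambda>\<xi>. G \<xi> * cis (\<xi> \<bullet> x) * of_real (gauss (\<xi> /\<^sub>R real (Suc i)))) \<in> borel_measurable lborel" for i
      using borel_measurable_times[OF Gm cm[of "real (Suc i)"]] by (simp add: mult.assoc)
    show "AE \<xi> in lborel. norm (G \<xi> * cis (\<xi> \<bullet> x) * of_real (gauss (\<xi> /\<^sub>R real (Suc i)))) \<le> norm (G \<xi>)" for i
      using gauss_bounds(2)[where 'a = 'a] by (intro AE_I2) (simp add: norm_mult mult_left_le)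
    have "(\<lambda>i. G \<xi> * cis (\<xi> \<bullet> x) * of_real (gauss (\<xi> /\<^sub>R real (Suc i)))) \<longlonglongrightarrow> G \<xi> * cis (\<xi> \<bullet> x) * of_real (exp (- (norm (0 *\<^sub>R \<xi>))\<^sup>2 / 2))" for \<xi>
      unfolding gauss_def by (intro tendsto_intros LIMSEQ_inverse_real_of_nat) simp
    then show "AE \<xi> in lborel. (\<lambda>i. G \<xi> * cis (\<xi> \<bullet> x) * of_real (gauss (\<xi> /\<^sub>R real (Suc i)))) \<longlonglongrightarrow> G \<xi> * cis (\<xi> \<bullet> x)"
      by simp
  qed
  moreover have "?I i = of_real (sqrt (2 * pi) ^ ?n) *
      (LINT y|lborel. \<phi> y * of_real (real (Suc i) ^ ?n * gauss (real (Suc i) *\<^sub>R (x - y))))" for i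
  proof -
    define k where "k = real (Suc i)"
    have k: "k > 0" by (simp add: k_def)
    let ?H = "\<lambda>\<xi> y. \<phi> y * (of_real (gauss (\<xi> /\<^sub>R k)) * cis (\<xi> \<bullet> (x - y)))"
    have cont_H: "continuous_on UNIV (\<lambda>p. ?H (fst p) (snd p))"
      unfolding gauss_def by (intro continuous_intros continuous_on_compose2[OF cont]) auto
    have H: "case_prod ?H \<in> borel_measurable (lborel \<Otimes>\<^sub>M lborel)"
      using borel_measurable_continuous_onI[OF cont_H] by (simp add: lborel_prod case_prod_unfold)
    have cont_F: "continuous_on UNIV (\<lambda>p. \<phi> (snd p) * cis (- (snd p \<bullet> fst p)))"
      by (intro continuous_intros continuous_on_compose2[OF cont]) auto
    have "(\<lambda>(\<xi>, y). \<phi> y * cis (- (y \<bullet> \<xi>))) \<in> borel_measurable (lborel \<Otimes>\<^sub>M lborel)"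
      using borel_measurable_continuous_onI[OF cont_F] by (simp add: lborel_prod case_prod_unfold)
    then have Fm: "(\<lambda>\<xi>. LINT y|lborel. \<phi> y * cis (- (y \<bullet> \<xi>))) \<in> borel_measurable lborel"
      by (rule lborel.borel_measurable_lebesgue_integral)
    have "?I i = (LINT \<xi>|lborel. (LINT y|lborel. \<phi> y * cis (- (y \<bullet> \<xi>))) * (cis (\<xi> \<bullet> x) * of_real (gauss (\<xi> /\<^sub>R k))))"
      unfolding k_def[symmetric] mult.assoc
    proof (rule integral_cong_AE)
      show "(\<lambda>\<xi>. G \<xi> * (cis (\<xi> \<bullet> x) * of_real (gauss (\<xi> /\<^sub>R k)))) \<in> borel_measurable lborel"
        using borel_measurable_times[OF Gm cm[of k]] by simp
      show "(\<lambda>\<xi>. (LINT y|lborel. \<phi> y * cis (- (y \<bullet> \<xi>))) * (cis (\<xi> \<bullet> x) * of_real (gauss (\<xi> /\<^sub>R k)))) \<in> borel_measurable lborel"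
        using borel_measurable_times[OF Fm, of "\<lambda>\<xi>. cis (\<xi> \<bullet> x) * of_real (gauss (\<xi> /\<^sub>R k))"] cm[of k] by simp
    qed (use eq in auto)
    also have "\<dots> = (LINT \<xi>|lborel. (LINT y|lborel. ?H \<xi> y))"
    proof -
      have eq_H: "\<phi> y * cis (- (y \<bullet> \<xi>)) * (cis (\<xi> \<bullet> x) * of_real (gauss (\<xi> /\<^sub>R k))) = ?H \<xi> y" for \<xi> y
      proof -
        have "cis (\<xi> \<bullet> (x - y)) = cis (- (y \<bullet> \<xi>)) * cis (\<xi> \<bullet> x)"
          by (simp add: cis_mult inner_diff_right inner_commute)
        then show ?thesis by (simp only: mult_ac)
      qed
      show ?thesis by (simp only: integral_mult_left_zero[symmetric] eq_H)
    qed
    also have "\<dots> = (LINT y|lborel. (LINT \<xi>|lborel. ?H \<xi> y))"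
    proof (rule lborel_pair.Fubini_integral[symmetric], rule lborel_pair.Fubini_integrable[OF H])
      have abs_H: "norm (?H \<xi> y) = gauss (\<xi> /\<^sub>R k) * norm (\<phi> y)" for \<xi> y
        using gauss_bounds(1)[of "\<xi> /\<^sub>R k"] by (simp add: norm_mult)
      show "integrable lborel (\<lambda>\<xi>. LINT y|lborel. norm (case (\<xi>, y) of (\<xi>, y) \<Rightarrow> ?H \<xi> y))"
        using integrable_gauss_scaled[OF k, where 'a = 'a] by (simp only: prod.case abs_H) simp
      show "AE \<xi> in lborel. integrable lborel (\<lambda>y. case (\<xi>, y) of (\<xi>, y) \<Rightarrow> ?H \<xi> y)"
      proof (intro AE_I2)
        fix \<xi>
        have "integrable lborel (\<lambda>y. \<phi> y * cis (\<xi> \<bullet> (x - y)))"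
        proof (rule Bochner_Integration.integrable_bound[OF \<phi>])
          have "continuous_on UNIV (\<lambda>y. \<phi> y * cis (\<xi> \<bullet> (x - y)))"
            by (intro continuous_intros cont)
          then show "(\<lambda>y. \<phi> y * cis (\<xi> \<bullet> (x - y))) \<in> borel_measurable lborel"
            using borel_measurable_continuous_onI by auto
        qed (simp add: norm_mult)
        from integrable_mult_right[OF this, of "of_real (gauss (\<xi> /\<^sub>R k))"]
        show "integrable lborel (\<lambda>y. case (\<xi>, y) of (\<xi>, y) \<Rightarrow> ?H \<xi> y)"
          by (simp add: mult_ac)
      qed
    qed
    also have "\<dots> = (LINT y|lborel. of_real (sqrt (2 * pi) ^ ?n) * (\<phi> y * of_real (k ^ ?n * gauss (k *\<^sub>R (x - y)))))"
    proof (rule Bochner_Integration.integral_cong[OF refl])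
      show "(LINT \<xi>|lborel. ?H \<xi> y)
          = of_real (sqrt (2 * pi) ^ ?n) * (\<phi> y * of_real (k ^ ?n * gauss (k *\<^sub>R (x - y))))" for y
        unfolding integral_mult_right_zero integral_gauss_scaled_cis[OF k] by simp
    qed
    finally show ?thesis by (simp only: k_def integral_mult_right_zero)
  qed
  ultimately have "(\<lambda>i. of_real (sqrt (2 * pi) ^ ?n) *
      (LINT y|lborel. \<phi> y * of_real (real (Suc i) ^ ?n * gauss (real (Suc i) *\<^sub>R (x - y)))))
      \<longlonglongrightarrow> (LINT \<xi>|lborel. G \<xi> * cis (\<xi> \<bullet> x))"
    by simp
  moreover have "(\<lambda>i. of_real (sqrt (2 * pi) ^ ?n) *
      (LINT y|lborel. \<phi> y * of_real (real (Suc i) ^ ?n * gauss (real (Suc i) *\<^sub>R (x - y)))))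
      \<longlonglongrightarrow> of_real (sqrt (2 * pi) ^ ?n) * (of_real (sqrt (2 * pi) ^ ?n) * \<phi> x)"
    by (intro tendsto_mult_left approximate_identity \<phi> cont)
  ultimately have "(LINT \<xi>|lborel. G \<xi> * cis (\<xi> \<bullet> x)) = of_real (sqrt (2 * pi) ^ ?n) * (of_real (sqrt (2 * pi) ^ ?n) * \<phi> x)"
    by (rule LIMSEQ_unique)
  also have "\<dots> = of_real (sqrt (2 * pi) ^ ?n * sqrt (2 * pi) ^ ?n) * \<phi> x"
    by (simp only: of_real_mult mult.assoc)
  also have "sqrt (2 * pi) ^ ?n * sqrt (2 * pi) ^ ?n = (2 * pi) ^ ?n"
    unfolding power_mult_distrib[symmetric] by simp
  finally show ?thesis .
qed

section \<open>From almost every slice to the whole torus\<close>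

lemma torus_periodic_int:
  assumes "torus_periodic f"
  shows "f (t + axis i (2 * pi * of_int k), x) = f (t, x)"
proof -
  have nat: "f (t + axis i (2 * pi * real n), x) = f (t, x)" for n t
  proof (induction n)
    case (Suc n)
    have "t + axis i (2 * pi * real (Suc n)) = (t + axis i (2 * pi * real n)) + axis i (2 * pi)"
      by (simp add: axis_def vec_eq_iff algebra_simps)
    then have "f (t + axis i (2 * pi * real (Suc n)), x) = f (t + axis i (2 * pi * real n), x)"
      using assms by (simp only: torus_periodic_def)
    with Suc show ?case by simp
  qed (simp add: axis_def vec_eq_iff zero_vec_def[symmetric])
  show ?thesis
  proof (cases "k \<ge> 0")
    case True
    then show ?thesis using nat[of t "nat k"] by simp
  next
    case False
    have "t + axis i (2 * pi * of_int k) + axis i (2 * pi * real (nat (- k))) = t"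
      using False by (simp add: axis_def vec_eq_iff)
    with nat[of "t + axis i (2 * pi * of_int k)" "nat (- k)"] show ?thesis by metis
  qed
qed

lemma torus_periodic_sum:
  assumes "torus_periodic f" "finite I"
  shows "f (t + (\<Sum>i\<in>I. axis i (2 * pi * of_int (k i))), x) = f (t, x)"
  using assms(2)
proof (induction I arbitrary: t)
  case (insert i I)
  then show ?case
    using torus_periodic_int[OF assms(1), of "t" i "k i" x] by (simp add: add.assoc[symmetric])
qed simp

lemma torus_periodic_reduce:
  fixes t :: "real^'m"
  obtains s where "s \<in> cbox 0 (\<chi> i. 2 * pi)"
    "\<And>f :: (real^'m) \<times> (real^'n) \<Rightarrow> complex. torus_periodic f \<Longrightarrow> (\<And>x. f (t, x) = f (s, x))"
proof -
  define k where "k i = \<lfloor>t $ i / (2 * pi)\<rfloor>" for i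
  define s where "s = (\<chi> i. t $ i - 2 * pi * of_int (k i))"
  have "s \<in> cbox 0 (\<chi> i. 2 * pi)"
  proof -
    have "0 \<le> t $ i - 2 * pi * of_int (k i) \<and> t $ i - 2 * pi * of_int (k i) \<le> 2 * pi" for i
    proof -
      have "of_int (k i) \<le> t $ i / (2 * pi)" "t $ i / (2 * pi) \<le> of_int (k i) + 1"
        unfolding k_def by linarith+
      then show ?thesis by (simp add: field_simps)
    qed
    then show ?thesis by (simp add: mem_box_cart s_def)
  qed
  moreover have "(\<Sum>i\<in>UNIV. axis i (2 * pi * of_int (k i))) = (\<chi> i. 2 * pi * of_int (k i))"
    by (simp add: vec_eq_iff axis_def)
  then have "t = s + (\<Sum>i\<in>UNIV. axis i (2 * pi * of_int (k i)))"
    by (simp add: s_def vec_eq_iff)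
  then have "torus_periodic f \<Longrightarrow> f (t, x) = f (s, x)" for f :: "(real^'m) \<times> (real^'n) \<Rightarrow> complex" and x
    by (metis torus_periodic_sum finite)
  ultimately show ?thesis using that by blast
qed

text \<open>The set of \<open>t\<close> for which the slices of \<open>f\<close> and \<open>h\<close> agree is closed. Its complement in the open
  fundamental box is open and null, hence empty; taking the closure gives the closed box, and
  every point is a translate of a point of that box by a period.\<close>
lemma torus_periodic_eqI:
  fixes f h :: "(real^'m) \<times> (real^'n) \<Rightarrow> complex"
  assumes f: "torus_periodic f" "continuous_on UNIV f" and h: "torus_periodic h" "continuous_on UNIV h"
    and ae: "AE t in lborel. (\<forall>i. 0 \<le> t $ i \<and> t $ i < 2 * pi) \<longrightarrow> (\<forall>x. f (t, x) = h (t, x))"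
  shows "f = h"
proof -
  let ?c = "\<chi> i::'m. 2 * pi"
  let ?E = "{t. \<forall>x. f (t, x) = h (t, x)}"
  have "closed {t. f (t, x) = h (t, x)}" for x
    by (intro closed_Collect_eq continuous_on_compose2[OF f(2)] continuous_on_compose2[OF h(2)])
      (auto intro!: continuous_intros)
  then have closed: "closed ?E" by (rule closed_Collect_all)
  have "box 0 ?c - ?E = {}"
  proof (rule ccontr)
    assume "box 0 ?c - ?E \<noteq> {}"
    moreover have "open (box 0 ?c - ?E)" using closed by (intro open_Diff open_box)
    ultimately have "\<not> negligible (box 0 ?c - ?E)" using open_not_negligible by blast
    moreover have "box 0 ?c - ?E \<in> null_sets lborel"
    proof -
      have "AE t in lborel. t \<notin> box 0 ?c - ?E"
        using ae by eventually_elim (auto simp: mem_box_cart less_imp_le)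
      then show ?thesis using \<open>open (box 0 ?c - ?E)\<close> by (subst AE_iff_null_sets) auto
    qed
    ultimately show False by (simp add: negligible_iff_null_sets null_sets_completionI)
  qed
  then have "closure (box 0 ?c) \<subseteq> ?E" by (intro closure_minimal closed) blast
  moreover have "(\<chi> i. pi) \<in> box 0 ?c" by (simp add: mem_box_cart)
  then have "box 0 ?c \<noteq> {}" by blast
  ultimately have E: "cbox 0 ?c \<subseteq> ?E" by (simp add: closure_box)
  have "f (t, x) = h (t, x)" for t x
    using torus_periodic_reduce[of t] E f(1) h(1) by (metis (mono_tags) mem_Collect_eq subsetD)
  then show ?thesis by auto
qed

lemma fundamental_domain_borel:
  "{t :: real^'m. \<forall>i. 0 \<le> t $ i \<and> t $ i < 2 * pi} \<times> (UNIV :: (real^'n) set) \<in> sets borel"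
proof -
  have "{t :: real^'m. \<forall>i. 0 \<le> t $ i \<and> t $ i < 2 * pi} \<times> (UNIV :: (real^'n) set)
      = {p. \<forall>i. 0 \<le> fst p $ i} \<inter> {p. \<forall>i. fst p $ i < 2 * pi}" by auto
  moreover have "closed {p :: (real^'m) \<times> (real^'n). \<forall>i. 0 \<le> fst p $ i}"
    by (intro closed_Collect_all closed_Collect_le continuous_intros)
  moreover have "open {p :: (real^'m) \<times> (real^'n). \<forall>i. fst p $ i < 2 * pi}"
    unfolding Collect_all_eq by (intro open_INT ballI open_Collect_less continuous_intros) simp
  ultimately show ?thesis by (auto intro: borel_open borel_closed)
qed

lemma torus_periodic_fourier: "torus_periodic f \<Longrightarrow> torus_periodic (fourier \<sigma> f)"
  by (simp add: torus_periodic_def fourier_def)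

text \<open>Fubini's theorem on the fundamental domain.\<close>
lemma torus_measure_slices:
  fixes f :: "(real^'m) \<times> (real^'n) \<Rightarrow> complex" and P :: "(real^'m) \<times> (real^'n) \<Rightarrow> bool"
  assumes int: "integrable torus_measure f" and ae: "AE p in torus_measure. P p"
  shows "AE t in lborel. (\<forall>i. 0 \<le> t $ i \<and> t $ i < 2 * pi) \<longrightarrow>
    integrable lborel (\<lambda>x. f (t, x)) \<and> (AE x in lborel. P (t, x))"
proof -
  let ?Q = "{t :: real^'m. \<forall>i. 0 \<le> t $ i \<and> t $ i < 2 * pi} \<times> (UNIV :: (real^'n) set)"
  have Q: "?Q \<inter> space lborel \<in> sets lborel" using fundamental_domain_borel by simp
  have "integrable (lborel \<Otimes>\<^sub>M lborel) (\<lambda>p. indicator ?Q p *\<^sub>R f p)"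
    using int unfolding torus_measure_def integrable_restrict_space[OF Q] lborel_prod .
  from lborel_pair.AE_integrable_fst'[OF this]
  have 1: "AE t in lborel. integrable lborel (\<lambda>x. indicator ?Q (t, x) *\<^sub>R f (t, x))" .
  have "AE p in lborel \<Otimes>\<^sub>M lborel. p \<in> ?Q \<longrightarrow> P p"
    using ae unfolding torus_measure_def AE_restrict_space_iff[OF Q] lborel_prod .
  from lborel_pair.AE_pair[OF this]
  have 2: "AE t in lborel. AE x in lborel. (t, x) \<in> ?Q \<longrightarrow> P (t, x)" .
  from 1 2 show ?thesis
    by eventually_elim (auto simp: indicator_def)
qed

section \<open>Characterisation of Schwartz functions by the partial Fourier transform\<close>

theorem proposition2p2:
  fixes f :: "(real^'m) \<times> (real^'n) \<Rightarrow> complex"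
  assumes "f \<in> smooth_torus" and "integrable torus_measure f"
  shows "f \<in> schwartz_space \<longleftrightarrow>
    (\<exists>g \<in> smooth_torus.
       (AE p in torus_measure. partial_fourier f p = g p) \<and>
       (\<forall>(\<alpha> :: 'm \<Rightarrow> nat) (\<beta> :: 'n \<Rightarrow> nat) (N :: real). N > 0 \<longrightarrow>
          (\<exists>C > 0. \<forall>t \<xi>. norm (deriv_t \<alpha> (deriv_x \<beta> g) (t, \<xi>))
                         \<le> C * (1 + (norm \<xi>)\<^sup>2) powr (- N / 2))))"
proof
  assume "f \<in> schwartz_space"
  then have f: "torus_periodic f" "rapid f" by (simp_all add: schwartz_space_iff_rapid)
  define g where "g = partial_fourier f"
  have g: "rapid g" "torus_periodic g"
    unfolding g_def partial_fourier_eq by (simp_all add: rapid_fourier torus_periodic_fourier f)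
  then have "g \<in> smooth_torus" by (simp add: smooth_torus_def rapid_imp_C_k)
  moreover have "AE p in torus_measure. partial_fourier f p = g p" by (simp add: g_def)
  moreover have "\<exists>C > 0. \<forall>t \<xi>. norm (deriv_t \<alpha> (deriv_x \<beta> g) (t, \<xi>)) \<le> C * (1 + (norm \<xi>)\<^sup>2) powr (- N / 2)"
    if "N > 0" for \<alpha> :: "'m \<Rightarrow> nat" and \<beta> :: "'n \<Rightarrow> nat" and N :: real
    using rapidD(2)[OF rapid_deriv_t_deriv_x[OF g(1)], of \<alpha> \<beta>, unfolded decays_iff_powr, rule_format, OF that]
    by simp
  ultimately show "\<exists>g \<in> smooth_torus.
       (AE p in torus_measure. partial_fourier f p = g p) \<and>
       (\<forall>(\<alpha> :: 'm \<Rightarrow> nat) (\<beta> :: 'n \<Rightarrow> nat) (N :: real). N > 0 \<longrightarrow>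
          (\<exists>C > 0. \<forall>t \<xi>. norm (deriv_t \<alpha> (deriv_x \<beta> g) (t, \<xi>))
                         \<le> C * (1 + (norm \<xi>)\<^sup>2) powr (- N / 2)))"
    by blast
next
  assume "\<exists>g \<in> smooth_torus.
       (AE p in torus_measure. partial_fourier f p = g p) \<and>
       (\<forall>(\<alpha> :: 'm \<Rightarrow> nat) (\<beta> :: 'n \<Rightarrow> nat) (N :: real). N > 0 \<longrightarrow>
          (\<exists>C > 0. \<forall>t \<xi>. norm (deriv_t \<alpha> (deriv_x \<beta> g) (t, \<xi>))
                         \<le> C * (1 + (norm \<xi>)\<^sup>2) powr (- N / 2)))"
  then obtain g where g: "g \<in> smooth_torus" and ae: "AE p in torus_measure. partial_fourier f p = g p"
    and decay: "\<And>(\<alpha> :: 'm \<Rightarrow> nat) (\<beta> :: 'n \<Rightarrow> nat) (N :: real). N > 0 \<Longrightarrow>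
          \<exists>C > 0. \<forall>t \<xi>. norm (deriv_t \<alpha> (deriv_x \<beta> g) (t, \<xi>)) \<le> C * (1 + (norm \<xi>)\<^sup>2) powr (- N / 2)"
    by blast
  have "decays (deriv_t \<alpha> (deriv_x \<beta> g))" for \<alpha> \<beta>
    unfolding decays_iff_powr using decay[of _ \<alpha> \<beta>] by simp
  then have "rapid g" using g by (intro rapidI_multi_deriv) (simp_all add: smooth_torus_def smooth_def)
  define h where "h = (\<lambda>p. of_real (inverse ((2 * pi) ^ CARD('n))) * fourier 1 g p)"
  have h: "rapid h" "torus_periodic h"
    unfolding h_def using torus_periodic_fourier[of g 1] g
    by (auto intro!: rapid_cmult rapid_fourier \<open>rapid g\<close> simp: torus_periodic_def smooth_torus_def)
  have f: "torus_periodic f" "continuous_on UNIV f"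
    using assms(1) smoothD(1)[of f] by (simp_all add: smooth_torus_def smooth_def)
  have "AE t in lborel. (\<forall>i. 0 \<le> t $ i \<and> t $ i < 2 * pi) \<longrightarrow> (\<forall>x. f (t, x) = h (t, x))"
    using torus_measure_slices[OF assms(2) ae]
  proof (rule AE_mp, intro AE_I2 impI allI)
    fix t :: "real^'m" and x :: "real^'n"
    assume *: "(\<forall>i. 0 \<le> t $ i \<and> t $ i < 2 * pi) \<longrightarrow>
        integrable lborel (\<lambda>x. f (t, x)) \<and> (AE \<xi> in lborel. partial_fourier f (t, \<xi>) = g (t, \<xi>))"
      and t: "\<forall>i. 0 \<le> t $ i \<and> t $ i < 2 * pi"
    \<comment> \<open>The integral on the left is \<open>fourier 1 g (t, x)\<close>.\<close>
    have "(LINT \<xi>|lborel. g (t, \<xi>) * cis (\<xi> \<bullet> x)) = of_real ((2 * pi) ^ DIM(real^'n)) * f (t, x)"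
    proof (rule fourier_inversion)
      show "integrable lborel (\<lambda>x. f (t, x))" using * t by blast
      show "continuous_on UNIV (\<lambda>x. f (t, x))" by (rule continuous_slice[OF f(2)])
      show "integrable lborel (\<lambda>\<xi>. g (t, \<xi>))"
        \<comment> \<open>With \<open>\<sigma> = 0\<close> and \<open>\<xi> = 0\<close> the kernel is \<open>1\<close>.\<close>
        using rapid_slice_integrable[OF \<open>rapid g\<close>, of t 0 0] by simp
      show "AE \<xi> in lborel. (LINT y|lborel. f (t, y) * cis (- (y \<bullet> \<xi>))) = g (t, \<xi>)"
        using * t by (simp add: partial_fourier_eq fourier_def)
    qed
    then show "f (t, x) = h (t, x)"
      by (simp add: h_def fourier_def field_simps)
  qed
  then have "f = h" by (intro torus_periodic_eqI f h rapidD(1))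
  with h show "f \<in> schwartz_space" by (simp add: schwartz_space_iff_rapid)
qed

end
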